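(* Let $P$, $\zeta$ and, for $i\ge6$, the finite sequences $Q_i$ be as constructed in the context, and put $Q=Q_6^{l_6}Q_7^{l_7}Q_8^{l_8}\cdots$ (concatenation, where $Q_i^{l_i}$ is $Q_i$ repeated $l_i$ times), where $l_i=2^{4i^2}$. Then $Q$ is infinite in limit and fully divergent, and $$\psi_{P,Q}(\zeta)\in\left(RN(Q)\cap DN(Q)\right)\setminus N(Q).$$
   Context: General definitions. A basic sequence is a sequence $Q=(q_n)_{n\ge1}$ of integers $q_n\ge 2$. The $Q$-Cantor series expansion of $x\in\mathbb{R}$, abbreviated $x=E_0.E_1E_2\cdots$ w.r.t. $Q$, is the unique expansion $x=E_0+\sum_{n\ge1}\frac{E_n}{q_1\cdots q_n}$ with $E_0=\lfloor x\rfloor$, $E_n\in\{0,\ldots,q_n-1\}$ for $n\ge 1$, and $E_n\ne q_n-1$ infinitely often. For basic sequences $P,Q$ and $x=E_0.E_1E_2\cdots$ w.r.t. $P$, $\psi_{P,Q}(x)=\sum_{n\ge1}\frac{\min(E_n,q_n-1)}{q_1\cdots q_n}$. $Q$ is infinite in limit if $q_n\to\infty$. Put $Q_n^{(k)}=\sum_{j=1}^n\frac1{q_j\cdots q_{j+k-1}}$; $Q$ is fully divergent if $\lim_nQ_n^{(k)}=\infty$ for all $k\ge1$. A block of length $k$ is an ordered $k$-tuple of non-negative integers, and $N_n^Q(B,x)$ is the number of occurrences of $B$ starting at positions $\le n$ in the digits $E_1,E_2,\ldots$ of $x$ w.r.t. $Q$. $N(Q)$ is the set of $x$ with $\lim_nN_n^Q(B,x)/Q_n^{(k)}=1$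 for all $k\ge1$ and all blocks $B$ of length $k$; $RN(Q)$ is the set of $x$ with $\lim_nN_n^Q(B_1,x)/N_n^Q(B_2,x)=1$ for all $k\ge1$ and all blocks $B_1,B_2$ of length $k$; $DN(Q)$ is the set of $x$ such that $(q_1\cdots q_nx\bmod1)_{n\ge0}$ is uniformly distributed mod $1$. Construction of $P$ and $\zeta$. For a positive integer $b$ and a digit $j$ put $\nu_b((j))=2^{-b}$ if $0\le j\le b-1$, $\nu_b((b))=\frac{2^b-b}{2^b}$, $\nu_b((j))=0$ if $j>b$; for a block $B=(b_1,\ldots,b_k)$ put $\nu_b(B)=\prod_{j=1}^k\nu_b((b_j))$. For positive integers $b,w$ let $V_1,\ldots,V_{(b+1)^w}$ be all blocks of length $w$ with digits in $\{0,1,\ldots,b\}$ in lexicographic order, and let $V_{b,w}$ be the concatenation $V_1^{2^{bw}\nu_b(V_1)}V_2^{2^{bw}\nu_b(V_2)}\cdots V_{(b+1)^w}^{2^{bw}\nu_b(V_{(b+1)^w})}$, where $V^m$ is $V$ repeated $m$ times. For $i\ge6$ let $W_i=V_{i,i^2}=(w_{i,t})_{t=1}^{|W_i|}$, which has length $|W_i|=i^22^{i^3}$, and $l_i=2^{4i^2}$. Let $(E_1,E_2,\ldots)=W_6^{l_6}W_7^{l_7}W_8^{l_8}\cdots$, let $P=(p_n)$ be the basic sequence with $p_n=2^i$ whenever position $n$ lies in the part $W_i^{l_i}$ of this concatenation, and let $\zeta=\sum_{n\ge1}\frac{E_n}{p_1\cdots p_n}$. Construction of $Q_i$. For $i\ge6$,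 $Q_i=(q_{i,t})_{t=1}^{|W_i|}$ is defined as follows. If $w_{i,t}\in\{0,\ldots,i-1\}$, set $q_{i,t}=i$. The remaining $i^22^{i^3}-i^32^{i^3-i}$ indices $t$ (those with $w_{i,t}=i$) are divided into $i$ classes, each of $i2^{i^3}-i^22^{i^3-i}$ elements; for $t$ in the first class set $q_{i,t}=i^3$, and for $t$ in the $j$-th class, $2\le j\le i$, set $q_{i,t}=\lfloor i^2/(j-1)\rfloor$. *)

theory Defs
  imports "HOL-Analysis.Analysis" "HOL-Library.Stream"
begin

section \<open>Cantor series expansions\<close>

text \<open>
  Sequences indexed by the positive integers are functions on \<^typ>\<open>nat\<close>; the value at \<open>0\<close> of a
  basic sequence is never used.
\<close>

definition basic_seq :: "(nat \<Rightarrow> nat) \<Rightarrow> bool" where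
  "basic_seq q \<longleftrightarrow> (\<forall>n\<ge>1. q n \<ge> 2)"

definition cantor_expansion :: "(nat \<Rightarrow> nat) \<Rightarrow> real \<Rightarrow> (nat \<Rightarrow> int) \<Rightarrow> bool" where
  "cantor_expansion q x E \<longleftrightarrow>
     E 0 = \<lfloor>x\<rfloor> \<and>
     (\<forall>n\<ge>1. E n \<in> {0..int (q n) - 1}) \<and>
     (\<exists>\<^sub>\<infinity>n. E n \<noteq> int (q n) - 1) \<and>
     (\<lambda>n. of_int (E (Suc n)) / (\<Prod>j=1..Suc n. real (q j))) sums (x - of_int (E 0))"

text \<open>The expansion is unique when \<open>q\<close> is a basic sequence.\<close>

definition digit :: "(nat \<Rightarrow> nat) \<Rightarrow> real \<Rightarrow> nat \<Rightarrow> int" where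
  "digit q x = (THE E. cantor_expansion q x E)"

definition psi :: "(nat \<Rightarrow> nat) \<Rightarrow> (nat \<Rightarrow> nat) \<Rightarrow> real \<Rightarrow> real" where
  "psi p q x =
     (\<Sum>n. of_int (min (digit p x (Suc n)) (int (q (Suc n)) - 1)) / (\<Prod>j=1..Suc n. real (q j)))"

definition infinite_in_limit :: "(nat \<Rightarrow> nat) \<Rightarrow> bool" where
  "infinite_in_limit q \<longleftrightarrow> filterlim q at_top sequentially"

definition Qsum :: "(nat \<Rightarrow> nat) \<Rightarrow> nat \<Rightarrow> nat \<Rightarrow> real" where
  "Qsum q k n = (\<Sum>j=1..n. 1 / (\<Prod>i<k. real (q (j + i))))"

definition fully_divergent :: "(nat \<Rightarrow> nat) \<Rightarrow> bool" where
  "fully_divergent q \<longleftrightarrow> (\<forall>k\<ge>1. filterlim (Qsum q k) at_top sequentially)"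

definition block_count :: "(nat \<Rightarrow> nat) \<Rightarrow> nat list \<Rightarrow> nat \<Rightarrow> real \<Rightarrow> nat" where
  "block_count q B n x = card {m \<in> {1..n}. \<forall>i<length B. digit q x (m + i) = int (B ! i)}"

definition normal_set :: "(nat \<Rightarrow> nat) \<Rightarrow> real set" where
  "normal_set q =
     {x. \<forall>k\<ge>1. \<forall>B. length B = k \<longrightarrow>
           (\<lambda>n. real (block_count q B n x) / Qsum q k n) \<longlonglongrightarrow> 1}"

definition ratio_normal_set :: "(nat \<Rightarrow> nat) \<Rightarrow> real set" where
  "ratio_normal_set q =
     {x. \<forall>k\<ge>1. \<forall>B\<^sub>1 B\<^sub>2. length B\<^sub>1 = k \<and> length B\<^sub>2 = k \<longrightarrow>
           (\<lambda>n. real (block_count q B\<^sub>1 n x) / real (block_count q B\<^sub>2 n x)) \<longlonglongrightarrow> 1}"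

definition unif_dist_mod1 :: "(nat \<Rightarrow> real) \<Rightarrow> bool" where
  "unif_dist_mod1 u \<longleftrightarrow>
     (\<forall>a b. 0 \<le> a \<and> a < b \<and> b \<le> 1 \<longrightarrow>
        (\<lambda>N. real (card {n. n < N \<and> frac (u n) \<in> {a..<b}}) / real N) \<longlonglongrightarrow> b - a)"

definition dist_normal_set :: "(nat \<Rightarrow> nat) \<Rightarrow> real set" where
  "dist_normal_set q = {x. unif_dist_mod1 (\<lambda>n. (\<Prod>j=1..n. real (q j)) * x)}"


section \<open>The construction of \<open>P\<close> and \<open>\<zeta>\<close>\<close>

definition nu :: "nat \<Rightarrow> nat \<Rightarrow> real" where
  "nu b j = (if j < b then 1 / 2 ^ b else if j = b then (2 ^ b - real b) / 2 ^ b else 0)"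

definition nu_block :: "nat \<Rightarrow> nat list \<Rightarrow> real" where
  "nu_block b B = (\<Prod>d\<leftarrow>B. nu b d)"

definition lex_blocks :: "nat \<Rightarrow> nat \<Rightarrow> nat list list" where
  "lex_blocks b w = product_lists (replicate w [0..<Suc b])"

text \<open>
  The order in which \<^const>\<open>product_lists\<close> enumerates is the lexicographic one, as the next two
  lemmas confirm.
\<close>

lemma set_lex_blocks: "set (lex_blocks b w) = {B. length B = w \<and> set B \<subseteq> {0..b}}"
proof (induction w)
  case 0
  show ?case by (auto simp: lex_blocks_def)
next
  case (Suc w)
  have "set (lex_blocks b (Suc w)) = (\<Union>x\<in>{0..b}. (#) x ` set (lex_blocks b w))"
    unfolding lex_blocks_def replicate_Suc product_lists.simps
    by (simp add: atLeastLessThanSuc_atLeastAtMost del: upt_Suc)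
  also have "\<dots> = {B. length B = Suc w \<and> set B \<subseteq> {0..b}}"
    unfolding Suc.IH by (auto simp: length_Suc_conv image_iff)
  finally show ?case .
qed

lemma sorted_lex_blocks:
  "sorted_wrt (\<lambda>U V. (U, V) \<in> lexord {(x, y). x < y}) (lex_blocks b w)"
proof (induction w)
  case 0
  show ?case by (simp add: lex_blocks_def)
next
  case (Suc w)
  let ?R = "\<lambda>U V. (U, V) \<in> lexord {(x, y). x < (y :: nat)}"
  have *: "sorted_wrt ?R (concat (map (\<lambda>x. map (Cons x) L) xs))"
    if "sorted_wrt (<) xs" and "sorted_wrt ?R L" for L and xs :: "nat list"
    using that by (induction xs) (auto simp: sorted_wrt_append sorted_wrt_map)
  show ?case
    unfolding lex_blocks_def replicate_Suc product_lists.simps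
    by (rule *) (use Suc in \<open>simp_all add: lex_blocks_def del: upt_Suc\<close>)
qed

text \<open>The multiplicity \<open>2\<^sup>b\<^sup>w \<nu>\<^sub>b(V)\<close> is an integer, so the floor only changes its type; see
  \<open>floor_multiplicity\<close> below.\<close>

definition Vcat :: "nat \<Rightarrow> nat \<Rightarrow> nat list" where
  "Vcat b w =
     concat (map (\<lambda>V. concat (replicate (nat \<lfloor>2 ^ (b * w) * nu_block b V\<rfloor>) V)) (lex_blocks b w))"

lemma floor_multiplicity:
  assumes "set V \<subseteq> {0..b}"
  shows "nat \<lfloor>2 ^ (b * length V) * nu_block b V\<rfloor> = (\<Prod>d\<leftarrow>V. if d < b then 1 else 2 ^ b - b)"
proof -
  have le: "b \<le> 2 ^ b" by (simp add: less_imp_le)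
  have "2 ^ (b * length V) * nu_block b V = real (\<Prod>d\<leftarrow>V. if d < b then 1 else 2 ^ b - b)"
    using assms
  proof (induction V)
    case (Cons d V)
    have "2 ^ b * nu b d = real (if d < b then 1 else 2 ^ b - b)"
      using Cons.prems le by (auto simp: nu_def of_nat_diff)
    moreover have "2 ^ (b * length (d # V)) * nu_block b (d # V)
        = (2 ^ b * nu b d) * (2 ^ (b * length V) * nu_block b V)"
      by (simp add: nu_block_def power_add)
    ultimately show ?case using Cons by simp
  qed (simp add: nu_block_def)
  then show ?thesis by (metis floor_of_nat nat_int)
qed

lemma sum_list_lex_blocks_Suc:
  fixes f :: "nat list \<Rightarrow> nat"
  shows "(\<Sum>V\<leftarrow>lex_blocks b (Suc w). f V) = (\<Sum>x\<leftarrow>[0..<Suc b]. \<Sum>V\<leftarrow>lex_blocks b w. f (x # V))"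
proof -
  have "(\<Sum>V\<leftarrow>concat (map (\<lambda>x. map (Cons x) L) xs). f V) = (\<Sum>x\<leftarrow>xs. \<Sum>V\<leftarrow>L. f (x # V))"
    for L and xs :: "nat list"
    by (induction xs) (auto simp: o_def)
  then show ?thesis
    unfolding lex_blocks_def replicate_Suc product_lists.simps by blast
qed

lemma length_filter_Vcat:
  "length (filter p (Vcat b w)) =
     (\<Sum>V\<leftarrow>lex_blocks b w. (\<Prod>d\<leftarrow>V. if d < b then 1 else 2 ^ b - b) * length (filter p V))"
proof -
  have "length (filter p (concat (replicate m V))) = m * length (filter p V)" for m and V :: "nat list"
    by (induction m) auto
  moreover have "nat \<lfloor>2 ^ (b * w) * nu_block b V\<rfloor> = (\<Prod>d\<leftarrow>V. if d < b then 1 else 2 ^ b - b)"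
    if "V \<in> set (lex_blocks b w)" for V
    using that floor_multiplicity[of V b] by (auto simp: set_lex_blocks)
  ultimately show ?thesis
    unfolding Vcat_def by (simp add: filter_concat length_concat o_def cong: map_cong)
qed

lemma length_filter_Vcat_closed:
  "length (filter p (Vcat b (Suc w))) =
     Suc w * 2 ^ (b * w) * (\<Sum>x\<leftarrow>[0..<Suc b]. if p x then if x < b then 1 else 2 ^ b - b else 0)"
proof -
  define g :: "nat \<Rightarrow> nat" where "g d = (if d < b then 1 else 2 ^ b - b)" for d
  define c where "c = (\<Sum>x\<leftarrow>[0..<Suc b]. if p x then g x else 0)"
  have le: "b \<le> 2 ^ b" by (simp add: less_imp_le)
  have "map g [0..<b] = replicate b 1"
    by (auto simp: g_def intro!: nth_equalityI)
  then have g: "(\<Sum>x\<leftarrow>[0..<Suc b]. g x) = 2 ^ b"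
    using le by (simp add: sum_list_replicate) (simp add: g_def)
  have tot: "(\<Sum>V\<leftarrow>lex_blocks b w. \<Prod>d\<leftarrow>V. g d) = 2 ^ (b * w)" for w
  proof (induction w)
    case (Suc w)
    show ?case
      unfolding sum_list_lex_blocks_Suc
      using Suc g by (simp add: sum_list_const_mult sum_list_mult_const power_add del: upt_Suc)
  qed (simp add: lex_blocks_def)
  have "(\<Sum>V\<leftarrow>lex_blocks b w. (\<Prod>d\<leftarrow>V. g d) * length (filter p V)) * 2 ^ b = w * 2 ^ (b * w) * c" for w
  proof (induction w)
    case (Suc w)
    let ?S = "\<Sum>V\<leftarrow>lex_blocks b w. (\<Prod>d\<leftarrow>V. g d) * length (filter p V)"
    have "(\<Sum>V\<leftarrow>lex_blocks b w. (\<Prod>d\<leftarrow>x # V. g d) * length (filter p (x # V)))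
        = (if p x then g x else 0) * 2 ^ (b * w) + g x * ?S" for x
      by (simp add: algebra_simps sum_list_addf sum_list_const_mult tot)
    then have "(\<Sum>V\<leftarrow>lex_blocks b (Suc w). (\<Prod>d\<leftarrow>V. g d) * length (filter p V))
       = c * 2 ^ (b * w) + 2 ^ b * ?S"
      unfolding sum_list_lex_blocks_Suc
      by (simp add: sum_list_addf sum_list_mult_const c_def g del: upt_Suc)
    then have "(\<Sum>V\<leftarrow>lex_blocks b (Suc w). (\<Prod>d\<leftarrow>V. g d) * length (filter p V)) * 2 ^ b
       = c * 2 ^ (b * w) * 2 ^ b + 2 ^ b * (?S * 2 ^ b)"
      by (simp add: algebra_simps)
    also have "\<dots> = Suc w * 2 ^ (b * Suc w) * c"
      unfolding Suc by (simp add: algebra_simps power_add)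
    finally show ?case .
  qed (simp add: lex_blocks_def)
  from this[of "Suc w"] have "length (filter p (Vcat b (Suc w))) * 2 ^ b = Suc w * 2 ^ (b * w) * c * 2 ^ b"
    by (simp add: length_filter_Vcat flip: g_def) (simp add: power_add algebra_simps)
  then show ?thesis unfolding c_def g_def by simp
qed

definition Wblock :: "nat \<Rightarrow> nat list" where
  "Wblock i = Vcat i (i\<^sup>2)"

lemma length_Wblock:
  assumes "i \<ge> 6"
  shows "length (Wblock i) = i\<^sup>2 * 2 ^ (i ^ 3)"
proof -
  obtain w where w: "i\<^sup>2 = Suc w"
    using assms not0_implies_Suc[of "i\<^sup>2"] by auto
  have "map (\<lambda>x. if x < i then 1 else 2 ^ i - i) [0..<i] = replicate i (1::nat)"
    by (auto intro!: nth_equalityI)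
  then have s: "(\<Sum>x\<leftarrow>[0..<Suc i]. if x < i then 1 else 2 ^ i - i) = (2::nat) ^ i"
    by (simp add: sum_list_replicate less_imp_le)
  have "length (Wblock i) = Suc w * (2 ^ (i * w) * 2 ^ i)"
    using length_filter_Vcat_closed[of "\<lambda>_. True" i w] s
    by (simp add: Wblock_def w algebra_simps del: upt_Suc)
  also have "2 ^ (i * w) * 2 ^ i = (2::nat) ^ (i * Suc w)"
    by (simp add: power_add mult.commute)
  also have "i * Suc w = i ^ 3"
    using w by (simp add: power3_eq_cube power2_eq_square)
  finally show ?thesis by (simp add: w)
qed

definition reps :: "nat \<Rightarrow> nat" where
  "reps i = 2 ^ (4 * i\<^sup>2)"

text \<open>
  The infinite concatenation \<open>X\<^sub>6 X\<^sub>7 X\<^sub>8 \<dots>\<close> of nonempty finite sequences, with terms numbered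
  from \<open>1\<close>.
\<close>

definition concat_from6 :: "(nat \<Rightarrow> nat list) \<Rightarrow> nat \<Rightarrow> nat" where
  "concat_from6 X n = flat (smap X (fromN 6)) !! (n - 1)"

definition Eseq :: "nat \<Rightarrow> nat" where
  "Eseq = concat_from6 (\<lambda>i. concat (replicate (reps i) (Wblock i)))"

definition Pseq :: "nat \<Rightarrow> nat" where
  "Pseq = concat_from6 (\<lambda>i. concat (replicate (reps i) (replicate (length (Wblock i)) (2 ^ i))))"

definition zeta :: real where
  "zeta = (\<Sum>n. real (Eseq (Suc n)) / (\<Prod>j=1..Suc n. real (Pseq j)))"


section \<open>The construction of \<open>Q\<close>\<close>

text \<open>
  The construction does not say how the indices \<open>t\<close> with \<open>w\<^sub>i\<^sub>,\<^sub>t = i\<close> are divided into \<open>i\<close> classes of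
  the prescribed size. The division is therefore a parameter: \<open>cls i t \<in> {1..i}\<close> is the number of
  the class containing \<open>t\<close>. List indices \<open>t\<close> start at \<open>0\<close> here.
\<close>

definition class_division :: "(nat \<Rightarrow> nat \<Rightarrow> nat) \<Rightarrow> bool" where
  "class_division cls \<longleftrightarrow>
     (\<forall>i\<ge>6.
        (\<forall>t<length (Wblock i). Wblock i ! t = i \<longrightarrow> cls i t \<in> {1..i}) \<and>
        (\<forall>j\<in>{1..i}. card {t. t < length (Wblock i) \<and> Wblock i ! t = i \<and> cls i t = j}
                     = i * 2 ^ (i ^ 3) - i\<^sup>2 * 2 ^ (i ^ 3 - i)))"

text \<open>The prescribed class sizes add up, so such divisions exist.\<close>

lemma class_division_exists: "\<exists>cls. class_division cls"
proof -
  let ?ok = "\<lambda>i f. (\<forall>t<length (Wblock i). Wblock i ! t = i \<longrightarrow> f t \<in> {1..i}) \<and>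
        (\<forall>j\<in>{1..i}. card {t. t < length (Wblock i) \<and> Wblock i ! t = i \<and> f t = j}
                     = i * 2 ^ (i ^ 3) - i\<^sup>2 * 2 ^ (i ^ 3 - i))"
  have "\<exists>f. ?ok i f" if i6: "i \<ge> 6" for i
  proof -
    define m :: nat where "m = i * 2 ^ (i ^ 3) - i\<^sup>2 * 2 ^ (i ^ 3 - i)"
    define S where "S = {t. t < length (Wblock i) \<and> Wblock i ! t = i}"
    obtain w where w: "i\<^sup>2 = Suc w"
      using i6 not0_implies_Suc[of "i\<^sup>2"] by auto
    have e: "i * w = i ^ 3 - i"
    proof -
      have "i ^ 3 = i * Suc w" using w by (simp add: power3_eq_cube power2_eq_square)
      then show ?thesis by simp
    qed
    have "i \<le> i ^ 3" using i6 by (intro self_le_power) auto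
    then have e2: "(2::nat) ^ (i ^ 3 - i) * 2 ^ i = 2 ^ (i ^ 3)"
      by (simp flip: power_add)
    have "map (\<lambda>x. if x = i then if x < i then 1 else 2 ^ i - i else 0) [0..<i] = replicate i (0::nat)"
      by (auto intro!: nth_equalityI)
    then have z: "(\<Sum>x\<leftarrow>[0..<Suc i]. if x = i then if x < i then 1 else 2 ^ i - i else 0) = 2 ^ i - i"
      by (simp add: sum_list_replicate)
    have "card S = length (filter (\<lambda>x. x = i) (Wblock i))"
      by (simp add: S_def length_filter_conv_card)
    also have "\<dots> = i\<^sup>2 * 2 ^ (i ^ 3 - i) * (2 ^ i - i)"
      unfolding Wblock_def w length_filter_Vcat_closed e z by simp
    also have "\<dots> = i\<^sup>2 * 2 ^ (i ^ 3) - i\<^sup>2 * 2 ^ (i ^ 3 - i) * i"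
      by (simp add: diff_mult_distrib2 mult.assoc e2)
    also have "\<dots> = i * m"
      by (simp add: m_def diff_mult_distrib2 power2_eq_square algebra_simps)
    finally have "card S = i * m" .
    moreover have "finite S" by (simp add: S_def)
    ultimately obtain h where h: "bij_betw h S {0..<i * m}"
      using ex_bij_betw_finite_nat by metis
    define f where "f t = Suc (h t div m)" for t
    have "f t \<in> {1..i}" if "t \<in> S" for t
    proof -
      have "h t < i * m" using bij_betwE[OF h] that by auto
      then show ?thesis by (simp add: f_def Suc_le_eq less_mult_imp_div_less)
    qed
    moreover have "card {t \<in> S. f t = j} = m" if j: "j \<in> {1..i}" for j
    proof (cases "m = 0")
      case True
      then have "S = {}" using \<open>card S = i * m\<close> \<open>finite S\<close> by simp
      then show ?thesis using True by simp
    next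
      case False
      obtain j' where j': "j = Suc j'" "j' < i" using j by (cases j) auto
      have "h ` {t \<in> S. f t = j} = {x \<in> {0..<i * m}. x div m = j'}"
        using bij_betw_imp_surj_on[OF h] by (auto simp: f_def j')
      also have "\<dots> = {j' * m..<Suc j' * m}"
      proof -
        have le: "Suc j' * m \<le> i * m" using j' by (intro mult_right_mono) auto
        have div_eq: "x div m = j' \<longleftrightarrow> j' * m \<le> x \<and> x < Suc j' * m" for x
          using False less_eq_div_iff_mult_less_eq[of m j' x] div_less_iff_less_mult[of m x "Suc j'"]
          by linarith
        show ?thesis
          unfolding div_eq set_eq_iff mem_Collect_eq atLeastLessThan_iff
          using le by (meson le0 less_le_trans)
      qed
      finally have "card (h ` {t \<in> S. f t = j}) = m" by simp
      moreover have "inj_on h {t \<in> S. f t = j}"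
        using bij_betw_imp_inj_on[OF h] by (rule inj_on_subset) auto
      ultimately show ?thesis by (simp add: card_image)
    qed
    ultimately show ?thesis
      unfolding m_def[symmetric] by (intro exI[of _ f]) (auto simp: S_def)
  qed
  then have "\<forall>i\<in>{6..}. \<exists>f. ?ok i f" by simp
  from bchoice[OF this] show ?thesis
    unfolding class_division_def atLeast_iff Ball_def by simp
qed

definition Qblock :: "(nat \<Rightarrow> nat \<Rightarrow> nat) \<Rightarrow> nat \<Rightarrow> nat list" where
  "Qblock cls i =
     map (\<lambda>t. if Wblock i ! t < i then i
              else if cls i t = 1 then i ^ 3
              else i\<^sup>2 div (cls i t - 1))
       [0..<length (Wblock i)]"

definition Qseq :: "(nat \<Rightarrow> nat \<Rightarrow> nat) \<Rightarrow> nat \<Rightarrow> nat" where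
  "Qseq cls = concat_from6 (\<lambda>i. concat (replicate (reps i) (Qblock cls i)))"

end

theory Submission
  imports Defs "HOL-Real_Asymp.Real_Asymp"
begin

text \<open>
  Every digit of \<open>\<zeta>\<close> is smaller than the corresponding term of \<open>Q\<close>, so \<open>\<psi>\<^sub>P\<^sub>,\<^sub>Q(\<zeta>)\<close> has the same digits
  with respect to \<open>Q\<close> as \<open>\<zeta>\<close> has with respect to \<open>P\<close>. Since \<open>l\<^sub>i |W\<^sub>i|\<close> dwarfs \<open>|W\<^sub>i\<^sub>+\<^sub>1|\<close>, even after
  division by \<open>2\<^sup>i\<^sup>k\<close>, all limits in question are determined by the counts in one single copy of \<open>W\<^sub>i\<close>.

  Ratio normality: up to boundary effects, a block of length \<open>k\<close> with digits below \<open>i\<close> occurs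
  \<open>i\<^sup>2 2\<^bsup>i^3 - ik\<^esup>\<close> times in \<open>W\<^sub>i\<close>, whatever the block is.
  Distribution normality: \<open>q\<^sub>1\<dots>q\<^sub>n x\<close> mod 1 is close to \<open>E\<^sub>n\<^sub>+\<^sub>1/q\<^sub>n\<^sub>+\<^sub>1\<close>. Most digits of \<open>W\<^sub>i\<close> are equal to \<open>i\<close>, and
  this quotient is then close to \<open>(j - 1)/i\<close> on the \<open>j\<close>-th of the \<open>i\<close> classes of equal size.
  Failure of normality: on \<open>W\<^sub>i\<close> the terms of \<open>Q\<close> are at most \<open>i\<^sup>3\<close>, so one copy contributes at least
  \<open>2\<^bsup>i^3\<^esup>/i\<close> to \<open>Q\<^sup>(\<^sup>1\<^sup>)\<close>, whereas the digit \<open>0\<close> occurs only about \<open>i\<^sup>2 2\<^bsup>i^3 - i\<^esup>\<close> times in it.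
\<close>

section \<open>Concatenations of finite sequences\<close>

lemma flat_shift:
  assumes "\<forall>xs\<in>set xss. xs \<noteq> []"
  shows "flat (xss @- ws) = concat xss @- flat ws"
  using assms by (induction xss) (simp_all add: flat_Stream)

text \<open>Strong induction on the position: removing the first entry of \<open>ws\<close> removes
  the nonempty list \<open>concat xss\<close> from both sides and so lowers the position. This lets
  the concatenation of the parts \<open>W_i^{l_i}\<close> be treated as a concatenation of single
  copies.\<close>

lemma flat_flat:
  assumes "\<forall>xss\<in>sset ws. xss \<noteq> [] \<and> (\<forall>xs\<in>set xss. xs \<noteq> [])"
  shows "flat (flat ws) = flat (smap concat ws)"
proof -
  have "flat (flat ws) !! n = flat (smap concat ws) !! n" for n
    using assms
  proof (induction n arbitrary: ws rule: less_induct)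
    case (less n)
    obtain xss ws' where ws: "ws = xss ## ws'" by (cases ws)
    have ne: "xss \<noteq> []" "\<forall>xs\<in>set xss. xs \<noteq> []"
      using less.prems by (auto simp: ws)
    have cne: "concat xss \<noteq> []" using ne by (cases xss) auto
    have "flat (flat ws) = concat xss @- flat (flat ws')"
      using ne by (simp add: ws flat_Stream flat_shift)
    moreover have "flat (smap concat ws) = concat xss @- flat (smap concat ws')"
      using cne by (simp add: ws flat_Stream)
    moreover have "flat (flat ws') !! (n - length (concat xss))
        = flat (smap concat ws') !! (n - length (concat xss))" if "\<not> n < length (concat xss)"
      using that cne less.prems length_greater_0_conv[of "concat xss"]
      by (intro less.IH) (auto simp: ws simp del: length_greater_0_conv length_concat)
    ultimately show ?case
      by (metis shift_snth)
  qed
  then have "snth (flat (flat ws)) = snth (flat (smap concat ws))" by (rule ext)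
  then show ?thesis by (metis stream_smap_nats)
qed

lemma flat_smap_snth:
  assumes "\<forall>i\<in>sset ws. X i \<noteq> []" and "t < length (X (ws !! b))"
  shows "flat (smap X ws) !! ((\<Sum>c<b. length (X (ws !! c))) + t) = X (ws !! b) ! t"
  using assms
proof (induction b arbitrary: ws)
  case 0
  obtain i ws' where ws: "ws = i ## ws'" by (cases ws)
  show ?case using 0 by (simp add: ws flat_Stream shift_snth)
next
  case (Suc b)
  obtain i ws' where ws: "ws = i ## ws'" by (cases ws)
  show ?case using Suc
    unfolding sum.lessThan_Suc_shift
    by (simp add: ws flat_Stream shift_snth add.assoc)
qed

lemma smap_flat:
  assumes "\<forall>xs\<in>sset ws. xs \<noteq> []"
  shows "smap f (flat ws) = flat (smap (map f) ws)"
  using assms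
proof (coinduction arbitrary: ws)
  case Eq_stream
  then have ne: "shd ws \<noteq> []" and tl_ne: "\<forall>xs\<in>sset (stl ws). xs \<noteq> []"
    by (auto simp: shd_sset stl_sset)
  show ?case
  \<comment> \<open>The next state is \<open>ws\<close> without its first element; a first list that
    becomes empty is dropped, because the coinduction invariant demands nonempty lists.\<close>
  proof (intro conjI exI[of _ "if tl (shd ws) = [] then stl ws else tl (shd ws) ## stl ws"])
    show "stl (flat (smap (map f) ws))
        = flat (smap (map f) (if tl (shd ws) = [] then stl ws else tl (shd ws) ## stl ws))"
      using ne by (cases "shd ws") simp_all
  qed (use ne tl_ne in \<open>auto simp: hd_map\<close>)
qed

lemma snth_fromN: "fromN n !! c = n + c"
  by simp

section \<open>Ratios of partial sums\<close>

text \<open>Take the largest \<open>b\<close> with \<open>s b \<le> n\<close>: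
  \<open>s 0 = 0\<close> provides a candidate and \<open>b \<le> s b\<close> bounds all of
  them.\<close>

lemma partition_of_strict_mono:
  fixes s :: "nat \<Rightarrow> nat"
  assumes "strict_mono s" and "s 0 = 0"
  obtains b where "s b \<le> n" and "n < s (Suc b)"
proof -
  define b where "b = (GREATEST b. s b \<le> n)"
  have bd: "\<forall>b. s b \<le> n \<longrightarrow> b \<le> n"
    using strict_mono_imp_increasing[OF assms(1)] le_trans by blast
  have "s b \<le> n"
    unfolding b_def by (rule GreatestI_nat[where k = 0 and b = n]) (use assms(2) bd in auto)
  moreover have "n < s (Suc b)"
  proof (rule ccontr)
    assume "\<not> n < s (Suc b)"
    then have "Suc b \<le> b"
      unfolding b_def by (intro Greatest_le_nat[where b = n]) (use bd in auto)
    then show False by simp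
  qed
  ultimately show ?thesis by (rule that)
qed

text \<open>At the ends of blocks the estimates \<open>near\<close> add up, and the finitely many
  early blocks are outweighed because the sums of \<open>g\<close> diverge. Inside a block the error
  is at most a constant times its length, which \<open>gap\<close> makes negligible against what
  came before.\<close>

lemma ratio_of_block_sums:
  fixes s :: "nat \<Rightarrow> nat" and f g :: "nat \<Rightarrow> real"
  assumes s: "strict_mono s" "s 0 = 0"
    and f: "\<And>n. 0 \<le> f n" "\<And>n. f n \<le> 1"
    and g: "\<And>n. 0 \<le> g n" "\<And>n. g n \<le> 1"
    and near: "\<And>\<eta>. \<eta> > 0 \<Longrightarrow> \<forall>\<^sub>F b in sequentially.
        \<bar>sum f {s b..<s (Suc b)} - \<kappa> * sum g {s b..<s (Suc b)}\<bar> \<le> \<eta> * sum g {s b..<s (Suc b)}"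
    and gap: "\<And>\<eta>. \<eta> > 0 \<Longrightarrow> \<forall>\<^sub>F b in sequentially. real (s (Suc b) - s b) \<le> \<eta> * sum g {..<s b}"
  shows "filterlim (\<lambda>n. sum g {..<n}) at_top sequentially"
    and "(\<lambda>n. sum f {..<n} / sum g {..<n}) \<longlonglongrightarrow> \<kappa>"
proof -
  define H where "H n = sum g {..<n}" for n
  define D where "D n = sum f {..<n} - \<kappa> * H n" for n
  have mono: "H m \<le> H n" if "m \<le> n" for m n
    unfolding H_def using that g by (intro sum_mono2) auto
  have diff: "sum h {..<n} - sum h {..<m} = sum h {m..<n}" if "m \<le> n" for h :: "nat \<Rightarrow> real" and m n
    using sum_diff_nat_ivl[of 0 m n h] that by (simp add: lessThan_atLeast0)
  have smono: "s b \<le> s c" if "b \<le> c" for b c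
    using s(1) that by (simp add: strict_mono_less_eq)
  have gap1: "1 \<le> real (s (Suc b) - s b)" for b
    using strict_monoD[OF s(1), of b "Suc b"] by simp
  show top: "filterlim (\<lambda>n. sum g {..<n}) at_top sequentially"
    unfolding filterlim_at_top_gt[where c = 0]
  proof (intro allI impI)
    fix Z :: real assume "Z > 0"
    \<comment> \<open>A block has at least one position, so \<open>gap\<close> with the constant
      \<open>1 / Z\<close> forces the sum of \<open>g\<close> up to \<open>Z\<close>.\<close>
    from gap[of "1 / Z"] obtain b where b: "real (s (Suc b) - s b) \<le> 1 / Z * sum g {..<s b}"
      using \<open>Z > 0\<close> by (auto simp: eventually_sequentially)
    have "1 \<le> 1 / Z * H (s b)" using b gap1[of b] by (simp add: H_def)
    then have "Z \<le> H (s b)" using \<open>Z > 0\<close> by (simp add: field_simps)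
    then show "\<forall>\<^sub>F n in sequentially. Z \<le> sum g {..<n}"
      unfolding eventually_sequentially H_def[symmetric] using mono order_trans by blast
  qed
  have "\<forall>\<^sub>F n in sequentially. \<bar>D n\<bar> \<le> \<eta> * H n" if "\<eta> > 0" for \<eta>
  proof -
    \<comment> \<open>The final error has three shares: one \<theta> from the early blocks, one from
      the complete later blocks, and \<open>1 + \<bar>\<kappa>\<bar>\<close> times \<theta> from the
      incomplete last block.\<close>
    define \<theta> where "\<theta> = \<eta> / (3 + \<bar>\<kappa>\<bar>)"
    have \<theta>: "\<theta> > 0" using that by (simp add: \<theta>_def)
    obtain b0 where b0: "\<And>b. b \<ge> b0 \<Longrightarrow>
        \<bar>sum f {s b..<s (Suc b)} - \<kappa> * sum g {s b..<s (Suc b)}\<bar> \<le> \<theta> * sum g {s b..<s (Suc b)}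
        \<and> real (s (Suc b) - s b) \<le> \<theta> * H (s b)"
      using eventually_conj[OF near[OF \<theta>] gap[OF \<theta>]]
      by (auto simp: eventually_sequentially H_def)
    \<comment> \<open>Telescoping from \<open>b0\<close>: over each block, \<open>D\<close> changes
      by at most \<theta> times the increment of \<open>H\<close>.\<close>
    have at_ends: "\<bar>D (s b)\<bar> \<le> \<bar>D (s b0)\<bar> + \<theta> * (H (s b) - H (s b0))" if "b \<ge> b0" for b
      using that
    proof (induction b rule: dec_induct)
      case (step b)
      have "D (s (Suc b)) - D (s b) = sum f {s b..<s (Suc b)} - \<kappa> * sum g {s b..<s (Suc b)}"
        and "H (s (Suc b)) - H (s b) = sum g {s b..<s (Suc b)}"
        using diff[OF smono[of b "Suc b"], of f] diff[OF smono[of b "Suc b"], of g]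
        by (simp_all add: D_def H_def algebra_simps)
      then have "\<bar>D (s (Suc b)) - D (s b)\<bar> \<le> \<theta> * (H (s (Suc b)) - H (s b))"
        using b0[of b] step by simp
      moreover have "\<theta> * (H (s (Suc b)) - H (s b0))
          = \<theta> * (H (s (Suc b)) - H (s b)) + \<theta> * (H (s b) - H (s b0))"
        by (simp add: algebra_simps)
      ultimately show ?case using step.IH by linarith
    qed simp
    have "\<forall>\<^sub>F n in sequentially. \<bar>D (s b0)\<bar> / \<theta> \<le> H n"
      using top unfolding filterlim_at_top H_def by blast
    moreover have "\<forall>\<^sub>F n in sequentially. n \<ge> s b0"
      by (rule eventually_ge_at_top)
    ultimately show ?thesis
    proof eventually_elim
      case (elim n)
      obtain b where b: "s b \<le> n" "n < s (Suc b)"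
        using partition_of_strict_mono[OF s] .
      have "s b0 < s (Suc b)" using elim b by simp
      then have bb: "b \<ge> b0" using s(1) by (simp add: strict_mono_less)
      have "D n - D (s b) = (\<Sum>m\<in>{s b..<n}. f m - \<kappa> * g m)"
        using diff[OF b(1), of f] diff[OF b(1), of g]
        by (simp add: D_def H_def sum_subtractf sum_distrib_left[symmetric] algebra_simps)
      also have "\<bar>\<dots>\<bar> \<le> (\<Sum>m\<in>{s b..<n}. 1 + \<bar>\<kappa>\<bar>)"
      proof (rule order_trans[OF sum_abs sum_mono])
        fix m
        have "\<bar>\<kappa>\<bar> * g m \<le> \<bar>\<kappa>\<bar> * 1" using g by (intro mult_left_mono) auto
        then show "\<bar>f m - \<kappa> * g m\<bar> \<le> 1 + \<bar>\<kappa>\<bar>"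
          using f[of m] g(1)[of m] abs_triangle_ineq4[of "f m" "\<kappa> * g m"]
          by (simp add: abs_mult)
      qed
      also have "\<dots> = (1 + \<bar>\<kappa>\<bar>) * real (n - s b)" by simp
      also have "\<dots> \<le> (1 + \<bar>\<kappa>\<bar>) * (\<theta> * H n)"
      proof (intro mult_left_mono)
        have "real (n - s b) \<le> real (s (Suc b) - s b)" using b by simp
        also have "\<dots> \<le> \<theta> * H (s b)" using b0[OF bb] by blast
        also have "\<dots> \<le> \<theta> * H n" using mono[OF b(1)] \<theta> by simp
        finally show "real (n - s b) \<le> \<theta> * H n" .
      qed simp
      finally have 1: "\<bar>D n - D (s b)\<bar> \<le> (1 + \<bar>\<kappa>\<bar>) * (\<theta> * H n)" .
      have "\<theta> * (H (s b) - H (s b0)) \<le> \<theta> * H n"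
      proof (intro mult_left_mono)
        have "0 \<le> H (s b0)" unfolding H_def using g by (simp add: sum_nonneg)
        then show "H (s b) - H (s b0) \<le> H n" using mono[OF b(1)] by simp
      qed (use \<theta> in simp)
      moreover have "\<bar>D (s b0)\<bar> \<le> \<theta> * H n"
        using elim(1) \<theta> by (simp add: field_simps)
      ultimately have "\<bar>D n\<bar> \<le> (3 + \<bar>\<kappa>\<bar>) * (\<theta> * H n)"
        using 1 at_ends[OF bb] by (simp add: algebra_simps)
      then show ?case by (simp add: \<theta>_def add_nonneg_eq_0_iff)
    qed
  qed
  note small = this
  show "(\<lambda>n. sum f {..<n} / sum g {..<n}) \<longlonglongrightarrow> \<kappa>"
    unfolding tendsto_iff
  proof (intro allI impI)
    fix e :: real assume "e > 0"
    have "\<forall>\<^sub>F n in sequentially. 1 \<le> H n"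
      using top unfolding filterlim_at_top H_def by blast
    moreover have "\<forall>\<^sub>F n in sequentially. \<bar>D n\<bar> \<le> e / 2 * H n"
      using small[of "e / 2"] \<open>e > 0\<close> by simp
    ultimately show "\<forall>\<^sub>F n in sequentially. dist (sum f {..<n} / sum g {..<n}) \<kappa> < e"
    proof eventually_elim
      case (elim n)
      have "sum f {..<n} / sum g {..<n} - \<kappa> = D n / H n"
        using elim by (simp add: D_def H_def field_simps)
      moreover have "\<bar>D n / H n\<bar> \<le> e / 2"
        using elim by (simp add: abs_divide field_simps)
      ultimately show ?case using \<open>e > 0\<close> unfolding dist_real_def by linarith
    qed
  qed
qed

section \<open>Cantor series\<close>

context
  fixes q :: "nat \<Rightarrow> nat" and E :: "nat \<Rightarrow> int"
  assumes q: "basic_seq q"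
    and E: "\<forall>n\<ge>1. E n \<in> {0..int (q n) - 1}"
    and E_inf: "\<exists>\<^sub>\<infinity>n. E n \<noteq> int (q n) - 1"
begin

private definition D :: "nat \<Rightarrow> real" where
  "D n = (\<Prod>j=1..n. real (q j))"

private definition C :: "nat \<Rightarrow> real" where
  "C n = (\<Sum>m<n. of_int (E (Suc m)) / D (Suc m))"

private lemma D_Suc: "D (Suc n) = D n * real (q (Suc n))"
  by (simp add: D_def)

private lemma C_Suc: "C (Suc n) = C n + of_int (E (Suc n)) / D (Suc n)"
  by (simp add: C_def)

private lemma q_pos: "real (q (Suc n)) > 0"
  using q[unfolded basic_seq_def, rule_format, of "Suc n"] by simp

private lemma D_pos: "D n > 0"
  by (induction n) (use q_pos in \<open>auto simp: D_Suc\<close>, simp add: D_def)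

text \<open>The digit plus one is at most \<open>q (Suc n)\<close>, with equality only for the
  maximal digit; dividing by \<open>D (Suc n)\<close> turns this into a comparison of consecutive
  upper bounds for the series.\<close>

private lemma upper_Suc: "C (Suc n) + 1 / D (Suc n) \<le> C n + 1 / D n"
  and upper_Suc_strict: "E (Suc n) \<noteq> int (q (Suc n)) - 1 \<Longrightarrow> C (Suc n) + 1 / D (Suc n) < C n + 1 / D n"
proof -
  have eq: "1 / D n = real (q (Suc n)) / D (Suc n)"
    using q_pos[of n] D_pos[of n] by (simp add: D_Suc)
  have "E (Suc n) + 1 \<le> int (q (Suc n))" using E[rule_format, of "Suc n"] by simp
  then have "of_int (E (Suc n)) + 1 \<le> real (q (Suc n))" by linarith
  then have "(of_int (E (Suc n)) + 1) / D (Suc n) \<le> real (q (Suc n)) / D (Suc n)"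
    using D_pos[of "Suc n"] by (intro divide_right_mono) auto
  then show "C (Suc n) + 1 / D (Suc n) \<le> C n + 1 / D n"
    unfolding eq C_Suc by (simp add: add_divide_distrib)
  assume "E (Suc n) \<noteq> int (q (Suc n)) - 1"
  then have "of_int (E (Suc n)) + 1 < real (q (Suc n))"
    using \<open>E (Suc n) + 1 \<le> int (q (Suc n))\<close> by linarith
  then have "(of_int (E (Suc n)) + 1) / D (Suc n) < real (q (Suc n)) / D (Suc n)"
    using D_pos[of "Suc n"] by (intro divide_strict_right_mono) auto
  then show "C (Suc n) + 1 / D (Suc n) < C n + 1 / D n"
    unfolding eq C_Suc by (simp add: add_divide_distrib)
qed

private lemma C_mono: "incseq C"
  using E D_pos by (intro incseq_SucI) (simp add: C_Suc less_imp_le)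

private lemma upper_mono: "m \<le> n \<Longrightarrow> C n + 1 / D n \<le> C m + 1 / D m"
  using upper_Suc by (rule lift_Suc_antimono_le)

private lemma C_le_upper:
  assumes "m \<le> n" shows "C n \<le> C m + 1 / D m"
  using upper_mono[OF assms] D_pos[of n] by (simp add: add_increasing2 order_trans[rotated])

private lemma C_integer: "D n * C n \<in> \<int>"
proof (induction n)
  case (Suc n)
  have "D (Suc n) * C (Suc n) = D n * C n * real (q (Suc n)) + of_int (E (Suc n))"
    using D_pos[of "Suc n"] by (simp add: C_Suc distrib_left) (simp add: D_Suc)
  also have "\<dots> \<in> \<int>" using Suc by (intro Ints_add[OF Ints_mult]) auto
  finally show ?case .
qed (simp add: C_def)

lemma cantor_series_summable: "summable (\<lambda>n. of_int (E (Suc n)) / (\<Prod>j=1..Suc n. real (q j)))"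
proof -
  have "C n \<le> 1" for n using C_le_upper[of 0 n] by (simp add: C_def D_def)
  from incseq_convergent[OF C_mono allI[OF this]] obtain x where "C \<longlonglongrightarrow> x" by blast
  then have "(\<lambda>n. of_int (E (Suc n)) / (\<Prod>j=1..Suc n. real (q j))) sums x"
    by (simp only: sums_def C_def[abs_def] D_def)
  then show ?thesis by (rule sums_summable)
qed

context
  fixes x :: real
  assumes x: "(\<lambda>n. of_int (E (Suc n)) / (\<Prod>j=1..Suc n. real (q j))) sums x"
begin

private lemma C_lim: "C \<longlonglongrightarrow> x"
  using x by (simp add: sums_def C_def[abs_def] D_def)

private lemma C_bounds: "C n \<le> x" "x < C n + 1 / D n"
proof -
  show "C n \<le> x" using C_mono C_lim by (rule incseq_le)
  \<comment> \<open>A non-maximal digit after position \<open>n\<close> supplies one strict decrease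
    of the upper bounds, hence the strict inequality.\<close>
  obtain m where m: "m > n" "E m \<noteq> int (q m) - 1"
    using E_inf by (auto simp: INFM_nat)
  then obtain m' where m': "m = Suc m'" by (cases m) auto
  have "x \<le> C m + 1 / D m"
    using C_lim C_le_upper[of m] by (intro LIMSEQ_le_const2) auto
  also have "\<dots> < C m' + 1 / D m'"
    using upper_Suc_strict[of m'] m m' by simp
  also have "\<dots> \<le> C n + 1 / D n" using m m' by (intro upper_mono) auto
  finally show "x < C n + 1 / D n" .
qed

private lemma floor_eq: "of_int \<lfloor>D n * x\<rfloor> = D n * C n"
proof -
  obtain k where k: "D n * C n = of_int k" using C_integer[of n] by (auto elim: Ints_cases)
  have "D n * C n \<le> D n * x" using C_bounds(1)[of n] D_pos[of n] by simp
  moreover have "D n * x < D n * C n + 1"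
    using mult_strict_left_mono[OF C_bounds(2)[of n] D_pos[of n]] D_pos[of n]
    by (simp add: distrib_left)
  ultimately have "\<lfloor>D n * x\<rfloor> = k" unfolding k by (simp add: floor_eq_iff)
  then show ?thesis by (simp add: k)
qed

lemma cantor_series_unit_interval: "0 \<le> x" "x < 1"
  using C_bounds[of 0] by (simp_all add: C_def D_def)

text \<open>By \<open>floor_eq\<close> the fractional part is the tail
  \<open>D n * (x - C n)\<close>; the bounds for \<open>x\<close> at \<open>Suc n\<close>, scaled by
  \<open>D n\<close>, give both inequalities.\<close>

lemma frac_cantor_bounds:
  "of_int (E (Suc n)) / real (q (Suc n)) \<le> frac ((\<Prod>j=1..n. real (q j)) * x)"
  "frac ((\<Prod>j=1..n. real (q j)) * x) < (of_int (E (Suc n)) + 1) / real (q (Suc n))"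
proof -
  have fr: "frac ((\<Prod>j=1..n. real (q j)) * x) = D n * (x - C n)"
    using floor_eq[of n] by (simp add: frac_def D_def right_diff_distrib)
  have e: "e / real (q (Suc n)) = D n * (e / D (Suc n))" for e
    using D_pos[of n] by (simp add: D_Suc)
  show "of_int (E (Suc n)) / real (q (Suc n)) \<le> frac ((\<Prod>j=1..n. real (q j)) * x)"
    unfolding fr e using C_bounds(1)[of "Suc n"] D_pos[of n]
    by (intro mult_left_mono) (auto simp add: C_Suc)
  show "frac ((\<Prod>j=1..n. real (q j)) * x) < (of_int (E (Suc n)) + 1) / real (q (Suc n))"
    unfolding fr e using C_bounds(2)[of "Suc n"] D_pos[of n]
    by (intro mult_strict_left_mono) (auto simp add: C_Suc add_divide_distrib)
qed

text \<open>Recovers the digits from \<open>x\<close> alone, which is what makes the expansion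
  unique. It combines \<open>floor_eq\<close> at \<open>n\<close> and at
  \<open>Suc n\<close>.\<close>

lemma cantor_digit_eq_floor:
  "of_int (E (Suc n)) = \<lfloor>(\<Prod>j=1..Suc n. real (q j)) * x\<rfloor> - real (q (Suc n)) * \<lfloor>(\<Prod>j=1..n. real (q j)) * x\<rfloor>"
proof -
  have "D (Suc n) * C (Suc n) - real (q (Suc n)) * (D n * C n) = of_int (E (Suc n))"
    using D_pos[of "Suc n"] by (simp add: C_Suc distrib_left) (simp add: D_Suc)
  then show ?thesis using floor_eq[of n] floor_eq[of "Suc n"] by (simp add: D_def)
qed

end

end

section \<open>Uniqueness of expansions and the value of \<open>digit\<close>\<close>

lemma cantor_expansion_unique:
  assumes "basic_seq q" and "cantor_expansion q x E" and "cantor_expansion q x E'"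
  shows "E = E'"
proof
  fix n
  have E0: "E 0 = E' 0" using assms by (simp add: cantor_expansion_def)
  show "E n = E' n"
  proof (cases n)
    case (Suc m)
    have "of_int (F (Suc m)) = \<lfloor>(\<Prod>j=1..Suc m. real (q j)) * (x - of_int (E 0))\<rfloor>
        - real (q (Suc m)) * \<lfloor>(\<Prod>j=1..m. real (q j)) * (x - of_int (E 0))\<rfloor>"
      if "cantor_expansion q x F" "F 0 = E 0" for F
      using that assms(1) unfolding cantor_expansion_def
      by (intro cantor_digit_eq_floor) auto
    from this[OF assms(2)] this[OF assms(3)]
    have "of_int (E (Suc m)) = (of_int (E' (Suc m)) :: real)"
      by (simp only: E0)
    then show ?thesis by (simp add: Suc)
  qed (use E0 in simp)
qed

lemma digit_of_sums:
  assumes "basic_seq q" and "\<forall>n\<ge>1. E n \<in> {0..int (q n) - 1}"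
    and "\<exists>\<^sub>\<infinity>n. E n \<noteq> int (q n) - 1"
    and "(\<lambda>n. of_int (E (Suc n)) / (\<Prod>j=1..Suc n. real (q j))) sums x"
  shows "digit q x (Suc n) = E (Suc n)"
proof -
  \<comment> \<open>\<open>E 0\<close> does not occur in the series, whereas an expansion carries
    the integer part there; it is 0 because the sum lies in \<open>[0,1)\<close>.\<close>
  define E' where "E' = E(0 := 0)"
  have inf: "\<exists>\<^sub>\<infinity>n. E' n \<noteq> int (q n) - 1"
    using assms(3) unfolding INFM_nat_le E'_def by (metis Suc_le_D fun_upd_other nat.simps(3) Suc_leD le_SucI)
  have "\<lfloor>x\<rfloor> = 0"
    using cantor_series_unit_interval[OF assms] by (simp add: floor_eq_iff)
  then have "cantor_expansion q x E'"
    using assms inf by (simp add: cantor_expansion_def E'_def)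
  then have "digit q x = E'"
    unfolding digit_def using cantor_expansion_unique[OF assms(1)] by blast
  then show ?thesis by (simp add: E'_def)
qed

section \<open>The copies of the blocks\<close>

text \<open>The copies of all blocks, \<open>l_6\<close> copies of \<open>W_6\<close>, then
  \<open>l_7\<close> of \<open>W_7\<close> and so on, are numbered by \<open>b\<close> from 0; copy
  \<open>b\<close> is a copy of \<open>W_i\<close> for \<open>i = copy_idx b\<close>.\<close>

definition copy_idx :: "nat \<Rightarrow> nat" where
  "copy_idx b = flat (smap (\<lambda>i. replicate (reps i) i) (fromN 6)) !! b"

text \<open>Positions count from 0, so copy \<open>b\<close> carries the digits numbered
  \<open>start b + 1\<close> to \<open>start (Suc b)\<close>.\<close>

definition start :: "nat \<Rightarrow> nat" where
  "start b = (\<Sum>c<b. length (Wblock (copy_idx c)))"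

abbreviation copy :: "nat \<Rightarrow> nat set" where
  "copy b \<equiv> {start b..<start (Suc b)}"

lemma reps_pos: "reps i > 0"
  by (simp add: reps_def)

lemma copy_idx_ge_6: "copy_idx b \<ge> 6"
proof -
  have "copy_idx b \<in> sset (flat (smap (\<lambda>i. replicate (reps i) i) (fromN 6)))"
    unfolding copy_idx_def by (rule snth_sset)
  then show ?thesis
    using reps_pos by (subst (asm) sset_flat) (auto simp: stream.set_map)
qed

lemma Wblock_nonempty: "i \<ge> 6 \<Longrightarrow> length (Wblock i) > 0"
  by (simp add: length_Wblock)

lemma start_0: "start 0 = 0"
  by (simp add: start_def)

lemma start_Suc: "start (Suc b) = start b + length (Wblock (copy_idx b))"
  by (simp add: start_def)

lemma strict_mono_start: "strict_mono start"
  using Wblock_nonempty[OF copy_idx_ge_6] by (simp add: strict_mono_Suc_iff start_Suc)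

text \<open>Stated for an arbitrary family \<open>X\<close> because it serves the digits,
  \<open>P\<close> and \<open>Q\<close> alike. The parts are split into single copies by
  \<open>flat_flat\<close>, and then position \<open>t\<close> of copy \<open>b\<close> is read off.
  \<open>Suc\<close> converts to numbering from 1.\<close>

lemma concat_from6_in_copy:
  assumes len: "\<And>i. i \<ge> 6 \<Longrightarrow> length (X i) = length (Wblock i)"
    and t: "t < length (Wblock (copy_idx b))"
  shows "concat_from6 (\<lambda>i. concat (replicate (reps i) (X i))) (Suc (start b + t)) = X (copy_idx b) ! t"
proof -
  let ?idxs = "flat (smap (\<lambda>i. replicate (reps i) i) (fromN 6))"
  have ne: "\<forall>i\<in>{6..}. X i \<noteq> []"
    using len Wblock_nonempty by (metis atLeast_iff length_greater_0_conv)
  have sset_idxs: "\<forall>i\<in>sset ?idxs. X i \<noteq> []"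
    using ne reps_pos by (subst sset_flat) (auto simp: stream.set_map)
  have "flat (smap (\<lambda>i. concat (replicate (reps i) (X i))) (fromN 6))
      = flat (smap concat (smap (\<lambda>i. replicate (reps i) (X i)) (fromN 6)))"
    by (simp add: stream.map_comp o_def)
  also have "\<dots> = flat (flat (smap (\<lambda>i. replicate (reps i) (X i)) (fromN 6)))"
    using ne reps_pos by (intro flat_flat[symmetric]) (auto simp: stream.set_map)
  also have "flat (smap (\<lambda>i. replicate (reps i) (X i)) (fromN 6)) = smap X ?idxs"
    using reps_pos by (subst smap_flat) (auto simp: stream.set_map stream.map_comp o_def)
  finally have "concat_from6 (\<lambda>i. concat (replicate (reps i) (X i))) (Suc (start b + t))
      = flat (smap X ?idxs) !! (start b + t)"
    by (simp add: concat_from6_def)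
  moreover have "start b = (\<Sum>c<b. length (X (?idxs !! c)))"
    unfolding start_def copy_idx_def
    using len copy_idx_ge_6 by (intro sum.cong) (auto simp: copy_idx_def)
  moreover have "t < length (X (?idxs !! b))"
    using t len copy_idx_ge_6[of b] by (simp add: copy_idx_def)
  ultimately show ?thesis
    using flat_smap_snth[OF sset_idxs] by (simp add: copy_idx_def)
qed

text \<open>The sum counts the copies in all parts before that of \<open>W_{6+a}\<close>, and
  \<open>c\<close> is the number of the copy within its part.\<close>

lemma copy_idx_part:
  assumes "c < reps (6 + a)"
  shows "copy_idx ((\<Sum>a'<a. reps (6 + a')) + c) = 6 + a"
  using flat_smap_snth[of "fromN 6" "\<lambda>i. replicate (reps i) i" c a] assms reps_pos
  by (simp add: copy_idx_def snth_fromN del: snth_siterate)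

lemma copy_part:
  obtains a c where "b = (\<Sum>a'<a. reps (6 + a')) + c" and "c < reps (6 + a)"
proof -
  have "strict_mono (\<lambda>a. \<Sum>a'<a. reps (6 + a'))"
    using reps_pos by (simp add: strict_mono_Suc_iff)
  from partition_of_strict_mono[OF this, of b] obtain a
    where "(\<Sum>a'<a. reps (6 + a')) \<le> b" "b < (\<Sum>a'<Suc a. reps (6 + a'))" by auto
  then show ?thesis
    by (intro that[of a "b - (\<Sum>a'<a. reps (6 + a'))"]) auto
qed

lemma filterlim_copy_idx: "filterlim copy_idx at_top sequentially"
  unfolding filterlim_at_top eventually_sequentially
proof (intro allI exI impI)
  fix Z b assume b: "(\<Sum>a'<Z. reps (6 + a')) \<le> b"
  obtain a c where ac: "b = (\<Sum>a'<a. reps (6 + a')) + c" "c < reps (6 + a)"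
    using copy_part .
  have "Z \<le> a"
  proof (rule ccontr)
    assume "\<not> Z \<le> a"
    then have "(\<Sum>a'<Suc a. reps (6 + a')) \<le> (\<Sum>a'<Z. reps (6 + a'))"
      by (intro sum_mono2) auto
    then show False using ac b by simp
  qed
  then show "Z \<le> copy_idx b" using copy_idx_part[OF ac(2)] ac(1) by simp
qed

text \<open>The part of \<open>W_i\<close> is finished before the first copy of
  \<open>W_{i+1}\<close>, so all its copies are available for bounding earlier sums from
  below.\<close>

lemma previous_copies:
  assumes "copy_idx b = Suc i" and "i \<ge> 6"
  obtains S where "S \<subseteq> {..<b}" and "card S = reps i" and "\<forall>c\<in>S. copy_idx c = i"
proof -
  obtain a c where ac: "b = (\<Sum>a'<a. reps (6 + a')) + c" "c < reps (6 + a)"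
    using copy_part .
  obtain a' where a': "i = 6 + a'" using assms(2) le_Suc_ex by blast
  have "6 + a = Suc i" using copy_idx_part[OF ac(2)] ac(1) assms(1) by simp
  then have a: "a = Suc a'" using a' by simp
  let ?m = "\<Sum>a'<a'. reps (6 + a')"
  show ?thesis
  proof (rule that[of "{?m..<?m + reps i}"])
    show "{?m..<?m + reps i} \<subseteq> {..<b}" by (auto simp: ac(1) a a')
    show "\<forall>c\<in>{?m..<?m + reps i}. copy_idx c = i"
    proof
      fix c assume "c \<in> {?m..<?m + reps i}"
      then have "copy_idx (?m + (c - ?m)) = 6 + a'"
        by (intro copy_idx_part) (auto simp: a')
      then show "copy_idx c = i"
        using \<open>c \<in> {?m..<?m + reps i}\<close> by (simp add: a')
    qed
  qed simp
qed

text \<open>This is where \<open>l_i = 2^{4i^2}\<close> enters. On the left stands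
  \<open>|W_{i+1}|\<close>, times a loss \<open>2^{ik}\<close> allowed per copy, times a margin
  \<open>2^i\<close>. Of the exponent \<open>4i^2\<close>, the difference
  \<open>(i+1)^3 - i^3\<close> takes \<open>3i^2 + 3i + 1\<close>, and the last \<open>i^2\<close>
  covers the terms of lower order once \<open>i \<ge> k + 7\<close>.\<close>

lemma part_outweighs_next_copy:
  assumes "i \<ge> k + 7"
  shows "(Suc i)\<^sup>2 * 2 ^ (Suc i ^ 3) * 2 ^ (i * k) * 2 ^ i \<le> reps i * (2 :: nat) ^ (i ^ 3)"
proof -
  have "(Suc i)\<^sup>2 \<le> (2 ^ i)\<^sup>2" by (intro power_mono) (simp_all add: Suc_le_eq)
  then have "(Suc i)\<^sup>2 * 2 ^ (Suc i ^ 3) * 2 ^ (i * k) * 2 ^ i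
      \<le> 2 ^ (2 * i) * 2 ^ (Suc i ^ 3) * 2 ^ (i * k) * (2 :: nat) ^ i"
    by (intro mult_right_mono) (simp_all add: power_mult mult.commute)
  also have "\<dots> = 2 ^ (2 * i + Suc i ^ 3 + i * k + i)"
    by (simp only: power_add)
  also have "\<dots> \<le> 2 ^ (4 * i\<^sup>2 + i ^ 3)"
  proof (intro power_increasing)
    have "Suc i ^ 3 = i ^ 3 + 3 * i\<^sup>2 + 3 * i + 1"
      by (simp add: power3_eq_cube power2_eq_square algebra_simps)
    moreover have "(k + 7) * i \<le> i\<^sup>2" using assms by (simp add: power2_eq_square)
    moreover have "(k + 7) * i = i * k + 7 * i" by (simp add: algebra_simps)
    moreover have "1 \<le> i" using assms by simp
    ultimately show "2 * i + Suc i ^ 3 + i * k + i \<le> 4 * i\<^sup>2 + i ^ 3" by linarith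
  qed simp
  finally show ?thesis by (simp add: reps_def power_add)
qed

text \<open>Reduces both conclusions to estimates for a single copy of \<open>W_i\<close>. By
  \<open>big\<close>, the finished part of \<open>W_i\<close> contributes at least
  \<open>reps i * 2^{i^3 - ik}\<close> to the sum of \<open>g\<close>, which outweighs the length of
  a copy of \<open>W_{i+1}\<close>; that is the hypothesis \<open>gap\<close>. The parameter
  \<open>k\<close> admits weights as thin as the occurrences of a block of length
  \<open>k\<close>.\<close>

proposition ratio_of_copy_sums:
  fixes f g :: "nat \<Rightarrow> real"
  assumes f: "\<And>n. 0 \<le> f n" "\<And>n. f n \<le> 1"
    and g: "\<And>n. 0 \<le> g n" "\<And>n. g n \<le> 1"
    and near: "\<And>\<eta>. \<eta> > 0 \<Longrightarrow> \<forall>\<^sub>F i in sequentially. \<forall>b. copy_idx b = i \<longrightarrow>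
        \<bar>sum f (copy b) - \<kappa> * sum g (copy b)\<bar> \<le> \<eta> * sum g (copy b)"
    and big: "\<forall>\<^sub>F i in sequentially. \<forall>b. copy_idx b = i \<longrightarrow> 2 ^ (i ^ 3) / 2 ^ (i * k) \<le> sum g (copy b)"
  shows "filterlim (\<lambda>n. sum g {..<n}) at_top sequentially"
    and "(\<lambda>n. sum f {..<n} / sum g {..<n}) \<longlonglongrightarrow> \<kappa>"
proof -
  \<comment> \<open>What holds on all copies of \<open>W_i\<close> for large \<open>i\<close> holds
    on all late copies, since \<open>copy_idx\<close> tends to infinity.\<close>
  have copies: "\<forall>\<^sub>F b in sequentially. P b" if "\<forall>\<^sub>F i in sequentially. \<forall>b. copy_idx b = i \<longrightarrow> P b" for P
    using eventually_compose_filterlim[OF that filterlim_copy_idx] by (rule eventually_mono) simp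
  have gap: "\<forall>\<^sub>F b in sequentially. real (start (Suc b) - start b) \<le> \<eta> * sum g {..<start b}"
    if \<eta>: "\<eta> > 0" for \<eta>
  proof (rule copies)
    have "(\<lambda>i. (1 / 2) ^ i :: real) \<longlonglongrightarrow> 0" by (rule LIMSEQ_realpow_zero) auto
    then have "\<forall>\<^sub>F i in sequentially. (1 / 2) ^ i < \<eta>"
      by (rule order_tendstoD) (use \<eta> in simp)
    with big have "\<forall>\<^sub>F i in sequentially. \<forall>b. copy_idx b = Suc i \<longrightarrow>
        real (start (Suc b) - start b) \<le> \<eta> * sum g {..<start b}"
      using eventually_ge_at_top[of "k + 7"]
    proof eventually_elim
      case (elim i)
      show ?case
      proof (intro allI impI)
        \<comment> \<open>The preceding part, that of \<open>W_i\<close>, supplies the lower bound,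
          so the estimate is proved at \<open>Suc i\<close> and shifted back afterwards.\<close>
        fix b assume b: "copy_idx b = Suc i"
        obtain S where S: "S \<subseteq> {..<b}" "card S = reps i" "\<forall>c\<in>S. copy_idx c = i"
          using previous_copies[OF b] elim by auto
        have "real (reps i) * (2 ^ (i ^ 3) / 2 ^ (i * k)) = (\<Sum>c\<in>S. 2 ^ (i ^ 3) / 2 ^ (i * k))"
          by (simp add: S)
        also have "\<dots> \<le> (\<Sum>c\<in>S. sum g (copy c))"
          using elim S by (intro sum_mono) blast
        also have "\<dots> \<le> (\<Sum>c<b. sum g (copy c))"
          using S g by (intro sum_mono2) (auto intro: sum_nonneg)
        also have "\<dots> = sum g {..<start b}"
        proof (induction b)
          case (Suc b)
          have "sum g {..<start b} + sum g (copy b) = sum g {..<start (Suc b)}"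
            using sum.atLeastLessThan_concat[of 0 "start b" "start (Suc b)" g]
            by (simp add: lessThan_atLeast0 start_Suc)
          then show ?case using Suc by simp
        qed (simp add: start_0)
        finally have le: "real (reps i) * (2 ^ (i ^ 3) / 2 ^ (i * k)) \<le> sum g {..<start b}" .
        have "real ((Suc i)\<^sup>2 * 2 ^ (Suc i ^ 3) * 2 ^ (i * k) * 2 ^ i) \<le> real (reps i * 2 ^ (i ^ 3))"
          using part_outweighs_next_copy[of k i] elim by (intro of_nat_mono) auto
        then have "(real (Suc i))\<^sup>2 * 2 ^ (Suc i ^ 3) \<le> (1 / 2) ^ i * (real (reps i) * (2 ^ (i ^ 3) / 2 ^ (i * k)))"
          by (simp add: field_simps power_one_over del: of_nat_Suc power_Suc)
        also have "\<dots> \<le> \<eta> * sum g {..<start b}"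
          using elim le \<eta> by (intro mult_mono) auto
        finally show "real (start (Suc b) - start b) \<le> \<eta> * sum g {..<start b}"
          using elim by (simp add: start_Suc b length_Wblock del: of_nat_Suc power_Suc)
      qed
    qed
    then show "\<forall>\<^sub>F i in sequentially. \<forall>b. copy_idx b = i \<longrightarrow>
        real (start (Suc b) - start b) \<le> \<eta> * sum g {..<start b}"
      by (subst eventually_sequentially_Suc[symmetric])
  qed
  note * = ratio_of_block_sums[OF strict_mono_start start_0 f g copies[OF near] gap]
  show "filterlim (\<lambda>n. sum g {..<n}) at_top sequentially" by (rule *(1))
  show "(\<lambda>n. sum f {..<n} / sum g {..<n}) \<longlonglongrightarrow> \<kappa>" by (rule *(2))
qed

section \<open>Occurrences of blocks\<close>

definition units :: "nat \<Rightarrow> nat \<Rightarrow> nat list list" where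
  "units b w = concat (map (\<lambda>V. replicate (nat \<lfloor>2 ^ (b * w) * nu_block b V\<rfloor>) V) (lex_blocks b w))"

lemma concat_units: "concat (units b w) = Vcat b w"
proof -
  have "concat (concat (map (\<lambda>V. replicate (m V) V) Vs)) = concat (map (\<lambda>V. concat (replicate (m V) V)) Vs)"
    for m :: "nat list \<Rightarrow> nat" and Vs
    by (induction Vs) auto
  then show ?thesis by (simp add: units_def Vcat_def)
qed

lemma length_unit: "V \<in> set (units b w) \<Longrightarrow> length V = w"
  by (auto simp: units_def set_lex_blocks)

lemma length_lex_blocks: "length (lex_blocks b w) = Suc b ^ w"
  by (induction w) (simp_all add: lex_blocks_def length_concat o_def sum_list_triv del: upt_Suc)

lemma nth_concat_uniform:
  assumes "\<forall>V\<in>set Us. length V = w" and "j < length Us" and "r < w"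
  shows "concat Us ! (j * w + r) = Us ! j ! r"
  using assms
proof (induction Us arbitrary: j)
  case (Cons V Us)
  show ?case
  proof (cases j)
    case (Suc j')
    then have "concat (V # Us) ! (j * w + r) = concat Us ! (j' * w + r)"
      using Cons.prems by (simp add: nth_append)
    then show ?thesis using Cons Suc by simp
  qed (use Cons in \<open>simp add: nth_append\<close>)
qed simp

lemma length_concat_uniform:
  "\<forall>V\<in>set Us. length V = w \<Longrightarrow> length (concat Us) = length Us * w"
  by (induction Us) auto

text \<open>Weights and conditions both factor over the coordinates; the induction splits off the
  first coordinate and shifts \<open>P\<close>.\<close>

lemma weighted_count_product:
  "(\<Sum>V\<leftarrow>lex_blocks b w. (\<Prod>d\<leftarrow>V. g d) * of_bool (\<forall>t<w. P t (V ! t)))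
     = (\<Prod>t<w. \<Sum>x<Suc b. g x * of_bool (P t x) :: nat)"
proof (induction w arbitrary: P)
  case (Suc w)
  have "(\<Prod>d\<leftarrow>x # V. g d) * of_bool (\<forall>t<Suc w. P t ((x # V) ! t))
      = (g x * of_bool (P 0 x)) * ((\<Prod>d\<leftarrow>V. g d) * of_bool (\<forall>t<w. P (Suc t) (V ! t)))" for x V
    unfolding All_less_Suc2 by simp
  then have "(\<Sum>V\<leftarrow>lex_blocks b (Suc w). (\<Prod>d\<leftarrow>V. g d) * of_bool (\<forall>t<Suc w. P t (V ! t)))
      = (\<Sum>x\<leftarrow>[0..<Suc b]. g x * of_bool (P 0 x)) * (\<Prod>t<w. \<Sum>x<Suc b. g x * of_bool (P (Suc t) x))"
    unfolding sum_list_lex_blocks_Suc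
    by (simp only: sum_list_const_mult sum_list_mult_const Suc.IH[of "\<lambda>t. P (Suc t)"])
  also have "(\<Sum>x\<leftarrow>[0..<Suc b]. g x * of_bool (P 0 x)) = (\<Sum>x<Suc b. g x * of_bool (P 0 x))"
    by (simp only: interv_sum_list_conv_sum_set_nat atLeast_upt)
  finally show ?case by (simp only: prod.lessThan_Suc_shift)
qed (simp add: lex_blocks_def)

lemma length_filter_units:
  "length (filter p (units b w))
     = (\<Sum>V\<leftarrow>lex_blocks b w. (\<Prod>d\<leftarrow>V. if d < b then 1 else 2 ^ b - b) * of_bool (p V))"
proof -
  have "nat \<lfloor>2 ^ (b * w) * nu_block b V\<rfloor> = (\<Prod>d\<leftarrow>V. if d < b then 1 else 2 ^ b - b)"
    if "V \<in> set (lex_blocks b w)" for V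
    using that floor_multiplicity[of V b] by (auto simp: set_lex_blocks)
  moreover have "length (filter p (replicate m V)) = m * of_bool (p V)" for m V
    by simp
  ultimately show ?thesis
    unfolding units_def filter_concat length_concat map_map o_def
    by (intro arg_cong[where f = sum_list] map_cong) simp_all
qed

text \<open>Since \<open>length B \<le> w\<close>, the letters of \<open>B\<close> are prescribed at
  distinct coordinates modulo \<open>w\<close>. A prescribed digit below \<open>b\<close> has weight
  1 and a free coordinate has total weight \<open>2^b\<close>, so the count depends neither on the
  letters of \<open>B\<close> nor on the offset \<open>r\<close>.\<close>

lemma count_cyclic_occurrences:
  assumes B: "\<forall>d\<in>set B. d < b" and len: "length B \<le> w" and r: "r < w"
  shows "length (filter (\<lambda>V. \<forall>s<length B. V ! ((r + s) mod w) = B ! s) (units b w)) = 2 ^ (b * (w - length B))"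
proof -
  define g :: "nat \<Rightarrow> nat" where "g d = (if d < b then 1 else 2 ^ b - b)" for d
  define P where "P t x \<longleftrightarrow> (\<forall>s<length B. (r + s) mod w = t \<longrightarrow> x = B ! s)" for t x
  define T where "T = (\<lambda>s. (r + s) mod w) ` {..<length B}"
  have inj: "inj_on (\<lambda>s. (r + s) mod w) {..<length B}"
  proof (rule linorder_inj_onI')
    fix s s' assume s: "s \<in> {..<length B}" "s' \<in> {..<length B}" "s < s'"
    show "(r + s) mod w \<noteq> (r + s') mod w"
    proof
      assume "(r + s) mod w = (r + s') mod w"
      then have "w dvd (r + s') - (r + s)" using mod_eq_dvd_iff_nat[of "r + s" "r + s'" w] s by simp
      then have "w \<le> s' - s" using s by (auto dest!: dvd_imp_le)
      then show False using s len by simp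
    qed
  qed
  have T: "T \<subseteq> {..<w}" "card T = length B"
    using r card_image[OF inj] by (auto simp: T_def)
  have g_sum: "(\<Sum>x<Suc b. g x) = 2 ^ b"
    by (simp add: g_def less_imp_le)
  have "(\<Sum>x<Suc b. g x * of_bool (P t x)) = (if t \<in> T then 1 else 2 ^ b)" for t
  proof (cases "t \<in> T")
    case True
    then obtain s where s: "s < length B" "t = (r + s) mod w" by (auto simp: T_def)
    have "P t x \<longleftrightarrow> x = B ! s" for x
      using inj s by (auto simp: P_def inj_on_def)
    then have "(\<Sum>x<Suc b. g x * of_bool (P t x)) = (\<Sum>x<Suc b. if x = B ! s then g x else 0)"
      by (intro sum.cong) auto
    moreover have "B ! s < b" using B s by simp
    ultimately show ?thesis using True by (simp add: g_def)
  next
    case False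
    then have "P t x" for x by (auto simp: P_def T_def)
    then show ?thesis using False g_sum by simp
  qed
  then have "(\<Prod>t<w. \<Sum>x<Suc b. g x * of_bool (P t x)) = (\<Prod>t<w. if t \<in> T then 1 else 2 ^ b)"
    by simp
  also have "\<dots> = (2 ^ b) ^ card ({..<w} - T)"
    by (simp add: prod.If_cases Diff_eq)
  also have "\<dots> = 2 ^ (b * (w - length B))"
    using T by (simp add: card_Diff_subset finite_subset[OF T(1)] power_mult)
  finally have "(\<Prod>t<w. \<Sum>x<Suc b. g x * of_bool (P t x)) = 2 ^ (b * (w - length B))" .
  moreover have "(\<forall>t<w. P t (V ! t)) \<longleftrightarrow> (\<forall>s<length B. V ! ((r + s) mod w) = B ! s)" for V
    using r by (auto simp: P_def)
  ultimately show ?thesis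
    using weighted_count_product[where g = g and b = b and w = w and P = P]
    unfolding length_filter_units g_def by simp
qed

text \<open>The last indices of the runs of equal entries. The last index of the list is included,
  because what follows it lies outside the list.\<close>

definition changes :: "'a list \<Rightarrow> nat set" where
  "changes xs = {j. j < length xs \<and> (Suc j = length xs \<or> xs ! j \<noteq> xs ! Suc j)}"

lemma finite_changes: "finite (changes xs)"
  by (simp add: changes_def)

lemma card_changes_replicate_append: "card (changes (replicate m x @ ys)) \<le> Suc (card (changes ys))"
proof -
  \<comment> \<open>Only the last copy of \<open>x\<close> can be a new end of a run; all other ends
    come from \<open>ys\<close>, shifted by \<open>m\<close>.\<close>
  have "changes (replicate m x @ ys) \<subseteq> insert (m - 1) ((+) m ` changes ys)"
  proof
    fix j assume j: "j \<in> changes (replicate m x @ ys)"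
    then have le: "j < m + length ys" by (simp add: changes_def)
    show "j \<in> insert (m - 1) ((+) m ` changes ys)"
    proof (cases "j < m")
      case True
      then show ?thesis using j le by (auto simp: changes_def nth_append split: if_splits)
    next
      case False
      then obtain i where i: "j = m + i" using le_Suc_ex by (metis not_less)
      then have "i \<in> changes ys" using j by (auto simp: changes_def nth_append)
      then show ?thesis using i by simp
    qed
  qed
  then have "card (changes (replicate m x @ ys)) \<le> card (insert (m - 1) ((+) m ` changes ys))"
    by (intro card_mono) (auto simp: finite_changes)
  also have "\<dots> \<le> Suc (card (changes ys))"
    by (simp add: card_insert_if card_image finite_changes)
  finally show ?thesis .
qed

text \<open>Each of the \<open>(b+1)^w\<close> lexicographic blocks contributes at most one end of a
  run.\<close>

lemma card_changes_units: "card (changes (units b w)) \<le> Suc b ^ w"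
proof -
  have *: "card (changes (concat (map (\<lambda>V. replicate (m V) V) Vs))) \<le> length Vs"
    for m and Vs :: "nat list list"
  proof (induction Vs)
    case (Cons V Vs)
    then show ?case
      using card_changes_replicate_append[of "m V" V "concat (map (\<lambda>V. replicate (m V) V) Vs)"] by simp
  qed (simp add: changes_def)
  show ?thesis unfolding units_def length_lex_blocks[symmetric] by (rule *)
qed

section \<open>Occurrences of a block in one copy of \<open>W_i\<close>\<close>

definition occurs :: "nat list \<Rightarrow> nat \<Rightarrow> bool" where
  "occurs B n \<longleftrightarrow> (\<forall>s<length B. Eseq (Suc (n + s)) = B ! s)"

lemma Eseq_in_copy:
  assumes "t < length (Wblock (copy_idx b))"
  shows "Eseq (Suc (start b + t)) = Wblock (copy_idx b) ! t"
  unfolding Eseq_def using assms by (rule concat_from6_in_copy[rotated]) simp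

lemma sum_copy:
  fixes h :: "nat \<Rightarrow> real"
  shows "sum h (copy b) = (\<Sum>t<length (Wblock (copy_idx b)). h (start b + t))"
  using sum.shift_bounds_nat_ivl[of h 0 "start b" "length (Wblock (copy_idx b))"]
  by (simp add: start_Suc lessThan_atLeast0 add.commute)

text \<open>Inside a run of equal units, the occurrences of a block are the cyclic occurrences in the unit.
  Only the last unit of each run behaves differently.\<close>

lemma occurrences_in_copy:
  assumes B: "\<forall>d\<in>set B. d < i" and len: "length B \<le> i\<^sup>2" and b: "copy_idx b = i"
  shows "\<bar>(\<Sum>n\<in>copy b. of_bool (occurs B n)) - (real i)\<^sup>2 * 2 ^ (i * (i\<^sup>2 - length B))\<bar>
           \<le> (real i)\<^sup>2 * real (Suc i) ^ i\<^sup>2"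
proof -
  let ?w = "i\<^sup>2" and ?U = "units i (i\<^sup>2)"
  let ?cyc = "\<lambda>r V. \<forall>s<length B. V ! ((r + s) mod ?w) = B ! s"
  have unif: "\<forall>V\<in>set ?U. length V = ?w" using length_unit by blast
  have lenW: "length (Wblock i) = length ?U * ?w"
    using length_concat_uniform[OF unif] by (simp add: Wblock_def concat_units)
  have E: "Eseq (Suc (start b + (j * ?w + r))) = ?U ! j ! r" if "j < length ?U" "r < ?w" for j r
  proof -
    have "j * ?w + r < length ?U * ?w"
      using that mult_le_mono1[of "Suc j" "length ?U" ?w] by simp
    then have "Eseq (Suc (start b + (j * ?w + r))) = Wblock i ! (j * ?w + r)"
      using Eseq_in_copy[of "j * ?w + r" b] by (simp only: b lenW)
    then show ?thesis
      using nth_concat_uniform[OF unif that] by (simp add: Wblock_def concat_units)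
  qed
  have agree: "occurs B (start b + (j * ?w + r)) \<longleftrightarrow> ?cyc r (?U ! j)"
    if j: "j < length ?U" "j \<notin> changes ?U" and r: "r < ?w" for j r
  proof -
    have j': "Suc j < length ?U" "?U ! Suc j = ?U ! j"
      using j by (auto simp: changes_def)
    have "Eseq (Suc (start b + (j * ?w + r) + s)) = ?U ! j ! ((r + s) mod ?w)" if "s < length B" for s
    proof (cases "r + s < ?w")
      case True
      then show ?thesis using E[of j "r + s"] j by (simp add: add.assoc)
    next
      \<comment> \<open>Here \<open>B\<close> reaches beyond unit \<open>j\<close> but, having
        length at most \<open>i^2\<close>, not beyond the next unit, and that one equals unit
        \<open>j\<close>.\<close>
      case False
      then have m: "(r + s) mod ?w = r + s - ?w" "r + s - ?w < ?w"
        using r that len by (simp_all add: mod_if)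
      have "start b + (j * ?w + r) + s = start b + (Suc j * ?w + (r + s - ?w))"
        using False by simp
      then show ?thesis using E[OF j'(1) m(2)] j'(2) m(1) by (simp only:)
    qed
    then show ?thesis by (simp add: occurs_def)
  qed
  let ?o = "\<lambda>j r. of_bool (occurs B (start b + (j * ?w + r))) :: real"
  let ?c = "\<lambda>j r. of_bool (?cyc r (?U ! j)) :: real"
  have "(\<Sum>n\<in>copy b. of_bool (occurs B n)) = (\<Sum>t<length ?U * ?w. of_bool (occurs B (start b + t)) :: real)"
    unfolding sum_copy by (simp add: b lenW)
  also have "\<dots> = (\<Sum>j<length ?U. \<Sum>t\<in>{j * ?w..<j * ?w + ?w}. of_bool (occurs B (start b + t)))"
    by (rule sum.nat_group[symmetric])
  also have "\<dots> = (\<Sum>j<length ?U. \<Sum>r<?w. ?o j r)"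
    using sum.shift_bounds_nat_ivl[of "\<lambda>t. of_bool (occurs B (start b + t)) :: real" 0 "j * ?w" ?w for j]
    by (intro sum.cong[OF refl]) (simp add: lessThan_atLeast0 ac_simps)
  finally have o: "(\<Sum>n\<in>copy b. of_bool (occurs B n)) = (\<Sum>j<length ?U. \<Sum>r<?w. ?o j r)" .
  have "(\<Sum>j<length ?U. ?c j r) = 2 ^ (i * (?w - length B))" if "r < ?w" for r
  proof -
    have "(\<Sum>j<length ?U. ?c j r) = real (card {j. j < length ?U \<and> ?cyc r (?U ! j)})"
      by (subst sum_of_bool_eq) (simp_all add: Int_def)
    then show ?thesis
      using count_cyclic_occurrences[OF B len that] unfolding length_filter_conv_card by simp
  qed
  then have c: "(\<Sum>j<length ?U. \<Sum>r<?w. ?c j r) = (real i)\<^sup>2 * 2 ^ (i * (?w - length B))"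
    by (subst sum.swap) simp
  have "\<bar>(\<Sum>j<length ?U. \<Sum>r<?w. ?o j r) - (\<Sum>j<length ?U. \<Sum>r<?w. ?c j r)\<bar>
      = \<bar>\<Sum>j<length ?U. \<Sum>r<?w. ?o j r - ?c j r\<bar>"
    by (simp only: sum_subtractf)
  also have "\<dots> \<le> (\<Sum>j<length ?U. \<Sum>r<?w. \<bar>?o j r - ?c j r\<bar>)"
    by (intro order_trans[OF sum_abs] sum_mono sum_abs)
  \<comment> \<open>By \<open>agree\<close> the two indicators differ only in units that end a run,
    and there by at most 1 for each offset.\<close>
  also have "\<dots> \<le> (\<Sum>j<length ?U. \<Sum>r<?w. of_bool (j \<in> changes ?U))"
    using agree by (intro sum_mono) auto
  also have "\<dots> = real ?w * (\<Sum>j<length ?U. of_bool (j \<in> changes ?U))"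
    by (simp add: sum_distrib_left)
  also have "(\<Sum>j<length ?U. of_bool (j \<in> changes ?U)) = real (card (changes ?U))"
    by (subst sum_of_bool_eq) (auto simp: changes_def intro!: arg_cong[where f = card])
  also have "real ?w * \<dots> \<le> real ?w * real (Suc i ^ ?w)"
    using card_changes_units by (intro mult_left_mono of_nat_mono) auto
  finally show ?thesis by (simp only: o c of_nat_power)
qed

lemma digits_Wblock: "t < length (Wblock i) \<Longrightarrow> Wblock i ! t \<le> i"
  using nth_mem[of t "Wblock i"] by (auto simp: Wblock_def Vcat_def set_lex_blocks)

lemma position_in_copy:
  obtains b t where "n = start b + t" and "t < length (Wblock (copy_idx b))"
proof -
  obtain b where "start b \<le> n" "n < start (Suc b)"
    using partition_of_strict_mono[OF strict_mono_start start_0] .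
  then show ?thesis by (intro that[of b "n - start b"]) (auto simp: start_Suc)
qed

text \<open>Makes the boundary error of \<open>occurrences_in_copy\<close> negligible. From
  \<open>i + 1 \<le> 2^{i-2}\<close> follows \<open>(i+1)^{i^2} \<le> 2^{i^3 - 2i^2}\<close>, and
  the exponent \<open>2i^2\<close> gained covers \<open>ik + i\<close>.\<close>

lemma few_changes:
  assumes "i \<ge> 6" and "i \<ge> k + 1"
  shows "Suc i ^ i\<^sup>2 * 2 ^ (i * k) * 2 ^ i \<le> (2 :: nat) ^ (i ^ 3)"
proof -
  have "m + 7 \<le> 2 ^ 4 * 2 ^ m" for m :: nat by (induction m) auto
  from this[of "i - 6"] have "Suc i \<le> 2 ^ (i - 2)"
    using assms(1) by (simp only: flip: power_add) simp
  then have "Suc i ^ i\<^sup>2 \<le> (2 ^ (i - 2)) ^ i\<^sup>2" by (intro power_mono) auto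
  then have "Suc i ^ i\<^sup>2 * 2 ^ (i * k) * 2 ^ i \<le> (2 ^ (i - 2)) ^ i\<^sup>2 * 2 ^ (i * k) * (2 :: nat) ^ i"
    by (intro mult_right_mono) auto
  also have "\<dots> = 2 ^ ((i - 2) * i\<^sup>2 + i * k + i)"
    by (simp only: power_add power_mult)
  also have "\<dots> \<le> 2 ^ (i ^ 3)"
  proof (intro power_increasing)
    have "i * (k + 1) \<le> i * i" using assms by (intro mult_left_mono) auto
    moreover have "(i - 2) * i\<^sup>2 + 2 * i\<^sup>2 = (i - 2 + 2) * i\<^sup>2"
      by (simp only: add_mult_distrib)
    moreover have "i - 2 + 2 = i" using assms by simp
    moreover have "i * i\<^sup>2 = i ^ 3" by (simp add: power3_eq_cube power2_eq_square)
    ultimately show "(i - 2) * i\<^sup>2 + i * k + i \<le> i ^ 3"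
      by (simp only: power2_eq_square distrib_left mult_1_right)
  qed simp
  finally show ?thesis .
qed

lemma occurrences_in_copy_asymp:
  "\<forall>\<^sub>F i in sequentially. \<forall>b. copy_idx b = i \<longrightarrow>
     \<bar>(\<Sum>n\<in>copy b. of_bool (occurs B n)) - (real i)\<^sup>2 * (2 ^ (i ^ 3) / 2 ^ (i * length B))\<bar>
       \<le> (1 / 2) ^ i * ((real i)\<^sup>2 * (2 ^ (i ^ 3) / 2 ^ (i * length B)))"
  using eventually_ge_at_top[of 6] eventually_ge_at_top[of "length B + 1"]
    eventually_ge_at_top[of "Suc (Max (set B \<union> {0}))"]
proof eventually_elim
  case (elim i)
  have "d < i" if "d \<in> set B" for d
  proof -
    have "d \<le> Max (set B \<union> {0})" using that by (intro Max_ge) auto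
    then show ?thesis using elim(3) by linarith
  qed
  then have B: "\<forall>d\<in>set B. d < i" by blast
  have "i \<le> i\<^sup>2" by (simp add: power2_eq_square)
  then have len: "length B \<le> i\<^sup>2" using elim by linarith
  have "i * (i\<^sup>2 - length B) + i * length B = i ^ 3"
    using len by (simp add: power3_eq_cube power2_eq_square flip: add_mult_distrib2)
  then have "(2 :: real) ^ (i * (i\<^sup>2 - length B)) * 2 ^ (i * length B) = 2 ^ (i ^ 3)"
    by (simp flip: power_add)
  then have eq: "(2 :: real) ^ (i * (i\<^sup>2 - length B)) = 2 ^ (i ^ 3) / 2 ^ (i * length B)"
    by (simp add: field_simps)
  have "real (Suc i ^ i\<^sup>2 * 2 ^ (i * length B) * 2 ^ i) \<le> real (2 ^ (i ^ 3))"
    using few_changes[of i "length B"] elim by (intro of_nat_mono) auto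
  then have "real (Suc i) ^ i\<^sup>2 \<le> (1 / 2) ^ i * (2 ^ (i ^ 3) / 2 ^ (i * length B))"
    by (simp add: field_simps power_one_over del: of_nat_Suc power_Suc)
  then have "(real i)\<^sup>2 * real (Suc i) ^ i\<^sup>2
      \<le> (real i)\<^sup>2 * ((1 / 2) ^ i * (2 ^ (i ^ 3) / 2 ^ (i * length B)))"
    by (intro mult_left_mono) auto
  then have le: "(real i)\<^sup>2 * real (Suc i) ^ i\<^sup>2
      \<le> (1 / 2) ^ i * ((real i)\<^sup>2 * (2 ^ (i ^ 3) / 2 ^ (i * length B)))"
    by (simp only: mult.left_commute)
  show ?case
    using occurrences_in_copy[OF B len] order_trans[OF _ le] unfolding eq by blast
qed

text \<open>Once \<open>i \<ge> 1\<close>, the relative error \<open>(1/2)^i\<close> is at most one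
  half, so at least half of the main term survives.\<close>

lemma many_occurrences_in_copy:
  "\<forall>\<^sub>F i in sequentially. \<forall>b. copy_idx b = i \<longrightarrow>
     (real i)\<^sup>2 * (2 ^ (i ^ 3) / 2 ^ (i * length B)) \<le> 2 * (\<Sum>n\<in>copy b. of_bool (occurs B n))"
  using occurrences_in_copy_asymp[of B] eventually_ge_at_top[of 1]
proof eventually_elim
  case (elim i)
  have "(1 / 2 :: real) ^ i \<le> (1 / 2) ^ 1" using elim by (intro power_decreasing) auto
  then have "(1 / 2) ^ i * ((real i)\<^sup>2 * (2 ^ (i ^ 3) / 2 ^ (i * length B)))
      \<le> 1 / 2 * ((real i)\<^sup>2 * (2 ^ (i ^ 3) / 2 ^ (i * length B)))"
    by (intro mult_right_mono) auto
  moreover have "m \<le> 2 * s" if "\<bar>s - m\<bar> \<le> e" "e \<le> 1 / 2 * m" for s m e :: real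
    using that by linarith
  ultimately show ?case using elim(1) by blast
qed

proposition occurs_ratio:
  assumes "length B\<^sub>1 = length B\<^sub>2"
  shows "filterlim (\<lambda>N. \<Sum>n<N. of_bool (occurs B\<^sub>2 n) :: real) at_top sequentially"
    and "(\<lambda>N. (\<Sum>n<N. of_bool (occurs B\<^sub>1 n)) / (\<Sum>n<N. of_bool (occurs B\<^sub>2 n)) :: real) \<longlonglongrightarrow> 1"
proof -
  let ?f = "\<lambda>n. of_bool (occurs B\<^sub>1 n) :: real" and ?g = "\<lambda>n. of_bool (occurs B\<^sub>2 n) :: real"
  have near: "\<forall>\<^sub>F i in sequentially. \<forall>b. copy_idx b = i \<longrightarrow>
      \<bar>sum ?f (copy b) - 1 * sum ?g (copy b)\<bar> \<le> \<eta> * sum ?g (copy b)" if "\<eta> > 0" for \<eta>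
  proof -
    have "(\<lambda>i. (1 / 2) ^ i :: real) \<longlonglongrightarrow> 0" by (rule LIMSEQ_realpow_zero) auto
    then have "\<forall>\<^sub>F i in sequentially. (1 / 2) ^ i < \<eta> / 4"
      by (rule order_tendstoD) (use that in simp)
    with occurrences_in_copy_asymp[of B\<^sub>1] occurrences_in_copy_asymp[of B\<^sub>2] many_occurrences_in_copy[of B\<^sub>2]
    show ?thesis
    proof eventually_elim
      case (elim i)
      show ?case
      proof (intro allI impI)
        fix b assume b: "copy_idx b = i"
        \<comment> \<open>Both sums deviate from the same main term \<open>?m\<close> by at most
          \<open>\<eta> / 4 * ?m\<close>, and \<open>?m\<close> is at most twice the sum of
          \<open>?g\<close>; this explains the quarter.\<close>
        let ?m = "(real i)\<^sup>2 * (2 ^ (i ^ 3) / 2 ^ (i * length B\<^sub>2))"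
        have "(1 / 2) ^ i * ?m \<le> \<eta> / 4 * ?m"
          using elim(4) by (intro mult_right_mono) auto
        moreover have "\<eta> / 4 * ?m \<le> \<eta> / 4 * (2 * sum ?g (copy b))"
          using elim(3) b that by (intro mult_left_mono) auto
        moreover have "\<bar>sum ?f (copy b) - ?m\<bar> \<le> (1 / 2) ^ i * ?m"
          using elim(1) b assms by simp
        moreover have "\<bar>sum ?g (copy b) - ?m\<bar> \<le> (1 / 2) ^ i * ?m"
          using elim(2) b by simp
        ultimately show "\<bar>sum ?f (copy b) - 1 * sum ?g (copy b)\<bar> \<le> \<eta> * sum ?g (copy b)"
          by linarith
      qed
    qed
  qed
  have big: "\<forall>\<^sub>F i in sequentially. \<forall>b. copy_idx b = i \<longrightarrow>
      2 ^ (i ^ 3) / 2 ^ (i * length B\<^sub>2) \<le> sum ?g (copy b)"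
    using many_occurrences_in_copy[of B\<^sub>2] eventually_ge_at_top[of 2]
  proof eventually_elim
    case (elim i)
    \<comment> \<open>The factor \<open>i^2\<close> of the main term makes up for the 2 in
      \<open>many_occurrences_in_copy\<close>.\<close>
    have "(2 :: real) \<le> (real i)\<^sup>2"
      using elim power_mono[of 2 "real i" 2] by simp
    then have "2 * (2 ^ (i ^ 3) / 2 ^ (i * length B\<^sub>2)) \<le> (real i)\<^sup>2 * (2 ^ (i ^ 3) / 2 ^ (i * length B\<^sub>2))"
      by (intro mult_right_mono) auto
    then show ?case using elim(1) by force
  qed
  have bd: "0 \<le> ?f n" "?f n \<le> 1" "0 \<le> ?g n" "?g n \<le> 1" for n by auto
  note * = ratio_of_copy_sums[OF bd near big]
  show "filterlim (\<lambda>N. sum ?g {..<N}) at_top sequentially" by (rule *(1))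
  show "(\<lambda>N. sum ?f {..<N} / sum ?g {..<N}) \<longlonglongrightarrow> 1" by (rule *(2))
qed

section \<open>The digits of \<open>zeta\<close> with respect to \<open>P\<close>\<close>

lemma infinitely_many_zeros: "\<exists>\<^sub>\<infinity>n. Eseq n = 0"
proof -
  have "infinite {n. Eseq (Suc n) = 0}"
  proof
    assume fin: "finite {n. Eseq (Suc n) = 0}"
    have "\<forall>\<^sub>F N in sequentially. real (card {n. Eseq (Suc n) = 0}) + 1 \<le> (\<Sum>n<N. of_bool (occurs [0] n))"
      using occurs_ratio(1)[of "[0]" "[0]"] unfolding filterlim_at_top by blast
    then obtain N where "real (card {n. Eseq (Suc n) = 0}) + 1 \<le> (\<Sum>n<N. of_bool (occurs [0] n))"
      by (auto simp: eventually_sequentially)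
    also have "\<dots> = real (card {n. n < N \<and> Eseq (Suc n) = 0})"
      by (subst sum_of_bool_eq) (auto simp: occurs_def intro!: arg_cong[where f = card])
    also have "\<dots> \<le> real (card {n. Eseq (Suc n) = 0})"
      using fin by (intro of_nat_mono card_mono) auto
    finally show False by simp
  qed
  then have "infinite (Suc ` {n. Eseq (Suc n) = 0})"
    by (simp add: finite_image_iff)
  moreover have "Suc ` {n. Eseq (Suc n) = 0} \<subseteq> {n. Eseq n = 0}" by auto
  ultimately show ?thesis
    unfolding frequently_cofinite using infinite_super by blast
qed

text \<open>The successor records that no digit is maximal: on copies of \<open>W_i\<close> the
  digits are at most \<open>i\<close>, and \<open>i + 1 < 2^i\<close>.\<close>

lemma Pseq_gt: "Suc (Eseq (Suc n)) < Pseq (Suc n)"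
proof -
  obtain b t where n: "n = start b + t" "t < length (Wblock (copy_idx b))"
    by (rule position_in_copy)
  define i where "i = copy_idx b"
  have "Pseq (Suc n) = replicate (length (Wblock i)) (2 ^ i) ! t"
    unfolding Pseq_def n i_def using n(2) by (intro concat_from6_in_copy) auto
  then have "Pseq (Suc n) = 2 ^ i" using n by (simp add: i_def)
  moreover have "Eseq (Suc n) \<le> i" using n Eseq_in_copy digits_Wblock by (simp add: i_def)
  moreover have "Suc i < 2 ^ i"
    using copy_idx_ge_6[of b] unfolding i_def[symmetric]
    by (induction i rule: dec_induct) auto
  ultimately show ?thesis by simp
qed

lemma digit_zeta: "digit Pseq zeta (Suc n) = int (Eseq (Suc n))"
proof -
  let ?E = "\<lambda>n. int (Eseq n)"
  have P: "basic_seq Pseq"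
    unfolding basic_seq_def
  proof (intro allI impI)
    fix n :: nat assume "n \<ge> 1"
    then show "2 \<le> Pseq n" using Pseq_gt[of "n - 1"] by simp
  qed
  have E: "\<forall>n\<ge>1. ?E n \<in> {0..int (Pseq n) - 1}"
  proof (intro allI impI)
    fix n :: nat assume "n \<ge> 1"
    then show "?E n \<in> {0..int (Pseq n) - 1}" using Pseq_gt[of "n - 1"] by simp
  qed
  have inf: "\<exists>\<^sub>\<infinity>n. ?E n \<noteq> int (Pseq n) - 1"
    unfolding INFM_nat
  proof
    fix m show "\<exists>n>m. ?E n \<noteq> int (Pseq n) - 1"
      using Pseq_gt[of m] by (intro exI[of _ "Suc m"]) auto
  qed
  show ?thesis
  proof (rule digit_of_sums[OF P E inf])
    show "(\<lambda>n. of_int (?E (Suc n)) / (\<Prod>j=1..Suc n. real (Pseq j))) sums zeta"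
      using summable_sums[OF cantor_series_summable[OF P E inf]] by (simp only: zeta_def of_int_of_nat_eq)
  qed
qed

section \<open>The basic sequence \<open>Q\<close>\<close>

lemma Qsum_eq: "Qsum q k n = (\<Sum>j<n. 1 / (\<Prod>s<k. real (q (Suc j + s))))"
  unfolding Qsum_def
  using sum.atLeast1_atMost_eq[of "\<lambda>j. 1 / (\<Prod>s<k. real (q (j + s)))" n] by simp

text \<open>Counts the integers from the ceiling of \<open>x\<close> up to, but excluding, that of
  \<open>y\<close>; \<open>y \<le> real n\<close> keeps all of them below \<open>n\<close>.\<close>

lemma card_nat_ivl_lower:
  fixes x y :: real
  assumes "0 \<le> x" and "y \<le> real n"
  shows "y - x - 1 \<le> real (card {j. j < n \<and> x \<le> real j \<and> real j < y})"
proof -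
  have "{nat \<lceil>x\<rceil>..<nat \<lceil>y\<rceil>} \<subseteq> {j. j < n \<and> x \<le> real j \<and> real j < y}"
    using assms by (auto simp: nat_ceiling_le_eq zless_nat_eq_int_zless less_ceiling_iff)
  then have "card {nat \<lceil>x\<rceil>..<nat \<lceil>y\<rceil>} \<le> card {j. j < n \<and> x \<le> real j \<and> real j < y}"
    by (intro card_mono) auto
  moreover have "y \<le> real (nat \<lceil>y\<rceil>)" by (rule real_nat_ceiling_ge)
  moreover have "real (nat \<lceil>x\<rceil>) \<le> x + 1" using assms(1) by linarith
  ultimately show ?thesis by simp
qed

lemma card_nat_ivl_upper:
  fixes x y :: real
  assumes "x \<le> y" and "0 \<le> y"
  shows "real (card {j. j < n \<and> x \<le> real j \<and> real j < y}) \<le> y - x + 1"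
proof -
  have "{j. j < n \<and> x \<le> real j \<and> real j < y} \<subseteq> {nat \<lceil>x\<rceil>..<nat \<lceil>y\<rceil>}"
    by (auto simp: nat_ceiling_le_eq zless_nat_eq_int_zless less_ceiling_iff)
  then have "card {j. j < n \<and> x \<le> real j \<and> real j < y} \<le> card {nat \<lceil>x\<rceil>..<nat \<lceil>y\<rceil>}"
    by (intro card_mono) auto
  moreover have "x \<le> real (nat \<lceil>x\<rceil>)" by (rule real_nat_ceiling_ge)
  moreover have "real (nat \<lceil>y\<rceil>) \<le> y + 1" using assms(2) by linarith
  ultimately show ?thesis using assms(1) by simp
qed

context
  fixes cls :: "nat \<Rightarrow> nat \<Rightarrow> nat"
  assumes cls: "class_division cls"
begin

section \<open>The classes of positions and the size of the terms of \<open>Q\<close>\<close>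

private definition m :: "nat \<Rightarrow> nat" where
  "m i = i * 2 ^ (i ^ 3) - i\<^sup>2 * 2 ^ (i ^ 3 - i)"

text \<open>Numbered from 0: \<open>Cls i j\<close> is class \<open>j + 1\<close>, on which the
  digit divided by the term of \<open>Q\<close> is close to \<open>j / i\<close>.\<close>

private definition Cls :: "nat \<Rightarrow> nat \<Rightarrow> nat set" where
  "Cls i j = {t. t < length (Wblock i) \<and> Wblock i ! t = i \<and> cls i t = Suc j}"

private definition small :: "nat \<Rightarrow> nat set" where
  "small i = {t. t < length (Wblock i) \<and> Wblock i ! t < i}"

private lemma finite_Cls: "finite (Cls i j)"
  by (simp add: Cls_def)

private lemma finite_small: "finite (small i)"
  by (simp add: small_def)

private lemma card_Cls:
  assumes "i \<ge> 6" and "j < i"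
  shows "card (Cls i j) = m i"
  using cls assms unfolding class_division_def Cls_def m_def by force

private lemma card_UN_Cls:
  assumes "i \<ge> 6" and "J \<subseteq> {..<i}"
  shows "card (\<Union>j\<in>J. Cls i j) = card J * m i"
proof -
  have "card (\<Union>j\<in>J. Cls i j) = (\<Sum>j\<in>J. card (Cls i j))"
    using assms finite_Cls by (intro card_UN_disjoint) (auto simp: Cls_def finite_subset)
  also have "\<dots> = (\<Sum>j\<in>J. m i)" using assms card_Cls by (intro sum.cong) auto
  finally show ?thesis by simp
qed

private lemma positions_Wblock:
  assumes "i \<ge> 6"
  shows "{..<length (Wblock i)} = small i \<union> (\<Union>j<i. Cls i j)"
proof -
  have "t \<in> small i \<union> (\<Union>j<i. Cls i j)" if "t < length (Wblock i)" for t
  proof (cases "Wblock i ! t < i")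
    case False
    then have "Wblock i ! t = i" using digits_Wblock[OF that] by simp
    then have "cls i t \<in> {1..i}" using cls assms that by (simp add: class_division_def)
    then show ?thesis
      using \<open>Wblock i ! t = i\<close> that by (cases "cls i t") (auto simp: Cls_def Suc_le_eq)
  qed (use that in \<open>simp add: small_def\<close>)
  then show ?thesis by (auto simp: small_def Cls_def)
qed

private lemma power_cube_diff:
  assumes "i \<ge> 6"
  shows "(2 :: real) ^ (i ^ 3 - i) = 2 ^ (i ^ 3) / 2 ^ i"
  using assms self_le_power[of i 3] by (simp add: power_diff)

private lemma real_m:
  assumes "i \<ge> 6"
  shows "real (m i) = real i * 2 ^ (i ^ 3) * (1 - real i / 2 ^ i)"
proof -
  \<comment> \<open>Ensures that the subtraction of natural numbers in \<open>m\<close> does not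
    truncate.\<close>
  have "i\<^sup>2 * 2 ^ (i ^ 3 - i) \<le> i * (2 ^ i * 2 ^ (i ^ 3 - i))"
    using less_exp[of i] by (simp add: power2_eq_square)
  also have "2 ^ i * 2 ^ (i ^ 3 - i) = (2 :: nat) ^ (i ^ 3)"
    using assms self_le_power[of i 3] by (simp flip: power_add)
  finally have "real (m i) = real i * 2 ^ (i ^ 3) - (real i)\<^sup>2 * 2 ^ (i ^ 3 - i)"
    by (simp add: m_def of_nat_diff)
  then show ?thesis
    using assms by (simp add: power_cube_diff power2_eq_square algebra_simps)
qed

text \<open>Found by subtraction: the \<open>i\<close> classes of size \<open>m i\<close> are
  removed from \<open>|W_i|\<close>. The proportion \<open>i / 2^i\<close> that remains is
  negligible.\<close>

private lemma card_small:
  assumes "i \<ge> 6"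
  shows "real (card (small i)) = real i / 2 ^ i * real (length (Wblock i))"
proof -
  have "card {..<length (Wblock i)} = card (small i) + card (\<Union>j<i. Cls i j)"
    unfolding positions_Wblock[OF assms] using finite_Cls finite_small
    by (intro card_Un_disjoint) (auto simp: small_def Cls_def)
  then have "length (Wblock i) = card (small i) + i * m i"
    using assms by (simp add: card_UN_Cls)
  then have "real (card (small i)) = real (length (Wblock i)) - real i * real (m i)"
    by simp
  then show ?thesis
    using assms by (simp add: real_m length_Wblock power2_eq_square algebra_simps)
qed

private lemma length_Qblock: "length (Qblock cls i) = length (Wblock i)"
  by (simp add: Qblock_def)

private lemma Qblock_small: "t \<in> small i \<Longrightarrow> Qblock cls i ! t = i"
  by (simp add: Qblock_def small_def)

private lemma Qblock_Cls:
  "t \<in> Cls i j \<Longrightarrow> Qblock cls i ! t = (if j = 0 then i ^ 3 else i\<^sup>2 div j)"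
  by (auto simp: Qblock_def Cls_def)

private lemma Qblock_bounds:
  assumes "i \<ge> 6" and "t < length (Wblock i)"
  shows "Wblock i ! t < Qblock cls i ! t" and "i \<le> Qblock cls i ! t" and "Qblock cls i ! t \<le> i ^ 3"
proof -
  have "Wblock i ! t < Qblock cls i ! t \<and> i \<le> Qblock cls i ! t \<and> Qblock cls i ! t \<le> i ^ 3"
  proof (cases "t \<in> small i")
    case True
    then show ?thesis using assms self_le_power[of i 3] Qblock_small[OF True] by (simp add: small_def)
  next
    case False
    then obtain j where j: "j < i" "t \<in> Cls i j" using positions_Wblock[OF assms(1)] assms(2) by blast
    have W: "Wblock i ! t = i" using j by (simp add: Cls_def)
    show ?thesis
    proof (cases "j = 0")
      case True
      have "i ^ 1 < i ^ 3" using assms by (intro power_strict_increasing) auto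
      then show ?thesis using True Qblock_Cls[OF j(2)] W by simp
    next
      case False
      \<comment> \<open>\<open>(i + 1) * (i - 1)\<close> does not exceed \<open>i^2\<close>, so for
        \<open>0 < j < i\<close> the floor of \<open>i^2 / j\<close> is at least
        \<open>i + 1\<close> and exceeds the digit \<open>i\<close>.\<close>
      have "Suc i * j \<le> Suc i * (i - 1)" using j by (intro mult_left_mono) auto
      also have "\<dots> \<le> i\<^sup>2" by (simp add: power2_eq_square diff_mult_distrib2)
      finally have "Suc i \<le> i\<^sup>2 div j" using False by (simp add: less_eq_div_iff_mult_less_eq)
      moreover have "i\<^sup>2 div j \<le> i ^ 3"
        using div_le_dividend[of "i\<^sup>2" j] power_increasing[of 2 3 i] assms by linarith
      ultimately show ?thesis using False Qblock_Cls[OF j(2)] W by simp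
    qed
  qed
  then show "Wblock i ! t < Qblock cls i ! t" and "i \<le> Qblock cls i ! t" and "Qblock cls i ! t \<le> i ^ 3"
    by blast+
qed

lemma Qseq_in_copy:
  assumes "t < length (Wblock (copy_idx b))"
  shows "Qseq cls (Suc (start b + t)) = Qblock cls (copy_idx b) ! t"
  unfolding Qseq_def using assms by (intro concat_from6_in_copy) (simp_all add: length_Qblock)

lemma Eseq_less_Qseq: "Eseq (Suc n) < Qseq cls (Suc n)"
proof -
  obtain b t where n: "n = start b + t" "t < length (Wblock (copy_idx b))"
    by (rule position_in_copy)
  then show ?thesis
    using Qblock_bounds(1)[OF copy_idx_ge_6 n(2)] by (simp add: Qseq_in_copy Eseq_in_copy)
qed

lemma Qseq_ge_2: "Qseq cls (Suc n) \<ge> 2"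
proof -
  obtain b t where n: "n = start b + t" "t < length (Wblock (copy_idx b))"
    by (rule position_in_copy)
  then show ?thesis
    using Qblock_bounds(2)[OF copy_idx_ge_6 n(2)] copy_idx_ge_6[of b] by (simp add: Qseq_in_copy)
qed

section \<open>Growth of \<open>Q\<close>, full divergence, and the rarity of zeros\<close>

lemma basic_seq_Qseq: "basic_seq (Qseq cls)"
  unfolding basic_seq_def
proof (intro allI impI)
  fix n :: nat assume "n \<ge> 1"
  then show "2 \<le> Qseq cls n" using Qseq_ge_2[of "n - 1"] by simp
qed

lemma infinite_in_limit_Qseq: "infinite_in_limit (Qseq cls)"
  unfolding infinite_in_limit_def filterlim_sequentially_Suc[of "Qseq cls", symmetric]
  unfolding filterlim_at_top
proof
  fix Z
  have "\<forall>\<^sub>F b in sequentially. Z \<le> copy_idx b"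
    using filterlim_copy_idx unfolding filterlim_at_top by blast
  then obtain b0 where b0: "\<And>b. b \<ge> b0 \<Longrightarrow> Z \<le> copy_idx b"
    by (auto simp: eventually_sequentially)
  have "Z \<le> Qseq cls (Suc n)" if "n \<ge> start b0" for n
  proof -
    obtain b t where n: "n = start b + t" "t < length (Wblock (copy_idx b))"
      by (rule position_in_copy)
    have "start b0 < start (Suc b)" using that n by (simp add: start_Suc)
    then have "b \<ge> b0" by (simp add: strict_mono_less[OF strict_mono_start])
    then show ?thesis
      using b0[of b] Qblock_bounds(2)[OF copy_idx_ge_6 n(2)] n by (simp add: Qseq_in_copy)
  qed
  then show "\<forall>\<^sub>F n in sequentially. Z \<le> Qseq cls (Suc n)"
    unfolding eventually_sequentially by blast
qed

text \<open>Inside a copy of \<open>W_i\<close> the terms are at most \<open>i^3 \<le> 2^i\<close>,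
  so a window of \<open>k\<close> terms has product at most \<open>2^{ik}\<close>. Since
  \<open>ratio_of_copy_sums\<close> is applied for its divergence statement, \<open>g\<close> is
  compared with itself.\<close>

lemma fully_divergent_Qseq: "fully_divergent (Qseq cls)"
  unfolding fully_divergent_def
proof (intro allI impI)
  fix k :: nat assume "k \<ge> 1"
  define g where "g n = 1 / (\<Prod>s<k. real (Qseq cls (Suc n + s)))" for n
  have ge1: "1 \<le> (\<Prod>s<k. real (Qseq cls (Suc n + s)))" for n
  proof (intro prod_ge_1)
    fix s show "1 \<le> real (Qseq cls (Suc n + s))" using Qseq_ge_2[of "n + s"] by simp
  qed
  have bd: "0 \<le> g n" "g n \<le> 1" for n
    using ge1[of n] by (simp_all add: g_def)
  have "\<forall>\<^sub>F i in sequentially. real i ^ 3 \<le> 2 ^ i" by real_asymp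
  then have big: "\<forall>\<^sub>F i in sequentially. \<forall>b. copy_idx b = i \<longrightarrow> 2 ^ (i ^ 3) / 2 ^ (i * k) \<le> sum g (copy b)"
    using eventually_ge_at_top[of 6] eventually_ge_at_top[of k]
  proof eventually_elim
    case (elim i)
    show ?case
    proof (intro allI impI)
      fix b assume b: "copy_idx b = i"
      have "k \<le> 2 ^ (i ^ 3)"
      proof -
        have "i \<le> i ^ 3" using elim by (intro self_le_power) auto
        then show ?thesis using elim less_exp[of "i ^ 3"] by linarith
      qed
      moreover have "2 * 2 ^ (i ^ 3) \<le> i\<^sup>2 * (2 :: nat) ^ (i ^ 3)"
        using elim power_mono[of 6 i 2] by (intro mult_right_mono) auto
      ultimately have len: "2 ^ (i ^ 3) \<le> length (Wblock i) - k"
        using length_Wblock[OF elim(2)] by linarith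
      \<comment> \<open>Leaving out the last \<open>k\<close> positions keeps the window inside the
        copy; the factor \<open>i^2\<close> of \<open>|W_i|\<close> compensates for them.\<close>
      have g_ge: "1 / 2 ^ (i * k) \<le> g n" if n: "n \<in> {start b..<start (Suc b) - k}" for n
      proof -
        have "(\<Prod>s<k. real (Qseq cls (Suc n + s))) \<le> (\<Prod>s<k. 2 ^ i)"
        proof (intro prod_mono conjI)
          fix s assume s: "s \<in> {..<k}"
          have "n - start b + s < length (Wblock i)"
            using n s by (auto simp: start_Suc b)
          then have "Qseq cls (Suc (start b + (n - start b + s))) \<le> i ^ 3"
            using Qblock_bounds(3)[of i "n - start b + s"] elim Qseq_in_copy[of "n - start b + s" b] b by simp
          then have "real (Qseq cls (Suc n + s)) \<le> real (i ^ 3)" using n by simp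
          from order_trans[OF this[unfolded of_nat_power] elim(1)]
          show "real (Qseq cls (Suc n + s)) \<le> 2 ^ i" .
        qed simp
        then show ?thesis
          unfolding g_def using ge1[of n] by (intro divide_left_mono) (auto simp: power_mult)
      qed
      have "2 ^ (i ^ 3) / 2 ^ (i * k) = real (2 ^ (i ^ 3)) * (1 / 2 ^ (i * k))" by simp
      also have "\<dots> \<le> real (card {start b..<start (Suc b) - k}) * (1 / 2 ^ (i * k))"
        using len by (intro mult_right_mono of_nat_mono) (auto simp: start_Suc b)
      also have "\<dots> \<le> sum g {start b..<start (Suc b) - k}"
        using g_ge by (rule sum_bounded_below)
      also have "\<dots> \<le> sum g (copy b)"
        using bd by (intro sum_mono2) auto
      finally show "2 ^ (i ^ 3) / 2 ^ (i * k) \<le> sum g (copy b)" .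
    qed
  qed
  have near: "\<forall>\<^sub>F i in sequentially. \<forall>b. copy_idx b = i \<longrightarrow>
      \<bar>sum g (copy b) - 1 * sum g (copy b)\<bar> \<le> \<eta> * sum g (copy b)" if "\<eta> > 0" for \<eta>
    using bd that by (intro always_eventually) (simp add: sum_nonneg)
  have "filterlim (\<lambda>n. sum g {..<n}) at_top sequentially"
    using bd near big by (intro ratio_of_copy_sums(1)[of g g 1 k]) auto
  then show "filterlim (Qsum (Qseq cls) k) at_top sequentially"
    unfolding Qsum_eq[abs_def] g_def .
qed

text \<open>One copy of \<open>W_i\<close> has at most \<open>|W_i| i / 2^i\<close> zeros but
  contributes at least \<open>2^{i^3} / i\<close> to \<open>Qsum\<close>. The quotient
  \<open>i^4 / 2^i\<close> tends to 0, so \<open>ratio_of_copy_sums\<close> applies with \<kappa> =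
  0.\<close>

lemma zeros_vs_Qsum: "(\<lambda>n. (\<Sum>j<n. of_bool (occurs [0] j)) / Qsum (Qseq cls) 1 n) \<longlonglongrightarrow> 0"
proof -
  define g where "g n = 1 / real (Qseq cls (Suc n))" for n
  let ?f = "\<lambda>n. of_bool (occurs [0] n) :: real"
  have bd: "0 \<le> ?f n" "?f n \<le> 1" "0 \<le> g n" "g n \<le> 1" for n
    using Qseq_ge_2[of n] by (auto simp: g_def)
  have g_ge: "2 ^ (i ^ 3) / real i \<le> sum g (copy b)" if b: "copy_idx b = i" and i: "i \<ge> 6" for b i
  proof -
    have "1 / real i ^ 3 \<le> g (start b + t)" if "t \<in> {..<length (Wblock i)}" for t
    proof -
      have Q: "Qseq cls (Suc (start b + t)) \<le> i ^ 3" "2 \<le> Qseq cls (Suc (start b + t))"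
        using that Qseq_in_copy[of t b] Qblock_bounds(3)[OF i, of t] Qseq_ge_2[of "start b + t"] b by simp_all
      have "real (Qseq cls (Suc (start b + t))) \<le> real (i ^ 3)"
        using Q(1) by (rule of_nat_mono)
      then show ?thesis unfolding g_def using Q(2) i by (intro divide_left_mono mult_pos_pos) auto
    qed
    then have "real (card {..<length (Wblock i)}) * (1 / real i ^ 3) \<le> (\<Sum>t<length (Wblock i). g (start b + t))"
      by (rule sum_bounded_below)
    then show ?thesis
      using i by (simp add: sum_copy b length_Wblock power3_eq_cube power2_eq_square)
  qed
  have near: "\<forall>\<^sub>F i in sequentially. \<forall>b. copy_idx b = i \<longrightarrow>
      \<bar>sum ?f (copy b) - 0 * sum g (copy b)\<bar> \<le> \<eta> * sum g (copy b)" if \<eta>: "\<eta> > 0" for \<eta>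
  proof -
    have "(\<lambda>i. real i ^ 4 / 2 ^ i) \<longlonglongrightarrow> 0" by real_asymp
    then have "\<forall>\<^sub>F i in sequentially. real i ^ 4 / 2 ^ i < \<eta>"
      by (rule order_tendstoD) (use \<eta> in simp)
    then show ?thesis
      using eventually_ge_at_top[of 6]
    proof eventually_elim
      case (elim i)
      show ?case
      proof (intro allI impI)
        fix b assume b: "copy_idx b = i"
        \<comment> \<open>Zeros are among the digits below \<open>i\<close>, whose positions
          \<open>card_small\<close> counts.\<close>
        have "sum ?f (copy b) \<le> (\<Sum>t<length (Wblock i). of_bool (t \<in> small i))"
          unfolding sum_copy b using elim b
          by (intro sum_mono) (auto simp: occurs_def Eseq_in_copy small_def)
        also have "\<dots> = real (card (small i))"
          by (subst sum_of_bool_eq) (auto simp: small_def intro!: arg_cong[where f = card])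
        also have "\<dots> = real i ^ 4 / 2 ^ i * (2 ^ (i ^ 3) / real i)"
          using elim(2) by (simp add: card_small length_Wblock power2_eq_square power4_eq_xxxx field_simps)
        also have "\<dots> \<le> \<eta> * sum g (copy b)"
          using elim \<eta> g_ge[OF b] by (intro mult_mono) auto
        finally show "\<bar>sum ?f (copy b) - 0 * sum g (copy b)\<bar> \<le> \<eta> * sum g (copy b)"
          by (simp add: sum_nonneg)
      qed
    qed
  qed
  have big: "\<forall>\<^sub>F i in sequentially. \<forall>b. copy_idx b = i \<longrightarrow> 2 ^ (i ^ 3) / 2 ^ (i * 1) \<le> sum g (copy b)"
    using eventually_ge_at_top[of 6]
  proof eventually_elim
    case (elim i)
    have "real i \<le> 2 ^ i" using less_exp[of i] by (simp add: of_nat_le_iff flip: of_nat_power)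
    then have "2 ^ (i ^ 3) / 2 ^ (i * 1) \<le> (2 :: real) ^ (i ^ 3) / real i"
      using elim by (intro divide_left_mono) auto
    then show ?case using g_ge elim order_trans by blast
  qed
  have "(\<lambda>n. sum ?f {..<n} / sum g {..<n}) \<longlonglongrightarrow> 0"
    using bd near big by (rule ratio_of_copy_sums(2))
  then show ?thesis by (simp add: Qsum_eq g_def)
qed

section \<open>The digits of \<open>psi\<close> with respect to \<open>Q\<close>, ratio normality,
  failure of normality\<close>

private lemma expansion_hyps:
  "\<forall>n\<ge>1. int (Eseq n) \<in> {0..int (Qseq cls n) - 1}"
  "\<exists>\<^sub>\<infinity>n. int (Eseq n) \<noteq> int (Qseq cls n) - 1"
proof -
  show "\<forall>n\<ge>1. int (Eseq n) \<in> {0..int (Qseq cls n) - 1}"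
  proof (intro allI impI)
    fix n :: nat assume "n \<ge> 1"
    then show "int (Eseq n) \<in> {0..int (Qseq cls n) - 1}" using Eseq_less_Qseq[of "n - 1"] by simp
  qed
  have "\<exists>\<^sub>\<infinity>n. Eseq n = 0 \<and> n \<noteq> 0"
    using infinitely_many_zeros unfolding INFM_nat by (metis not_less0)
  then show "\<exists>\<^sub>\<infinity>n. int (Eseq n) \<noteq> int (Qseq cls n) - 1"
  proof (rule INFM_mono)
    fix n assume n: "Eseq n = 0 \<and> n \<noteq> 0"
    then show "int (Eseq n) \<noteq> int (Qseq cls n) - 1" using Qseq_ge_2[of "n - 1"] by simp
  qed
qed

lemma psi_sums:
  "(\<lambda>n. of_int (int (Eseq (Suc n))) / (\<Prod>j=1..Suc n. real (Qseq cls j))) sums psi Pseq (Qseq cls) zeta"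
proof -
  \<comment> \<open>The minimum keeps every digit of \<open>zeta\<close>, since all of them are
    below the terms of \<open>Q\<close>.\<close>
  have "min (digit Pseq zeta (Suc n)) (int (Qseq cls (Suc n)) - 1) = int (Eseq (Suc n))" for n
    using Eseq_less_Qseq[of n] by (simp add: digit_zeta)
  then show ?thesis
    using summable_sums[OF cantor_series_summable[OF basic_seq_Qseq expansion_hyps]]
    by (simp only: psi_def)
qed

lemma digit_psi: "digit (Qseq cls) (psi Pseq (Qseq cls) zeta) (Suc n) = int (Eseq (Suc n))"
  using digit_of_sums[OF basic_seq_Qseq expansion_hyps psi_sums] .

text \<open>\<open>occurs\<close> numbers starting positions from 0 and \<open>block_count\<close>
  from 1, hence the image under \<open>Suc\<close> in the proof.\<close>

lemma block_count_psi:
  "real (block_count (Qseq cls) B N (psi Pseq (Qseq cls) zeta)) = (\<Sum>n<N. of_bool (occurs B n))"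
proof -
  have "{n \<in> {1..N}. \<forall>i<length B. digit (Qseq cls) (psi Pseq (Qseq cls) zeta) (n + i) = int (B ! i)}
      = Suc ` {n. n < N \<and> occurs B n}"
  proof -
    have "(\<forall>i<length B. digit (Qseq cls) (psi Pseq (Qseq cls) zeta) (Suc (n + i)) = int (B ! i)) \<longleftrightarrow> occurs B n" for n
      by (simp add: occurs_def digit_psi)
    then have "n \<in> {n \<in> {1..N}. \<forall>i<length B. digit (Qseq cls) (psi Pseq (Qseq cls) zeta) (n + i) = int (B ! i)}
        \<longleftrightarrow> n \<in> Suc ` {n. n < N \<and> occurs B n}" for n
      by (cases n) (simp_all add: image_iff Suc_le_eq)
    then show ?thesis by blast
  qed
  then have "real (block_count (Qseq cls) B N (psi Pseq (Qseq cls) zeta)) = real (card {n. n < N \<and> occurs B n})"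
    by (simp add: block_count_def card_image)
  also have "\<dots> = (\<Sum>n<N. of_bool (occurs B n))"
    by (subst sum_of_bool_eq) (auto intro!: arg_cong[where f = card])
  finally show ?thesis .
qed

lemma psi_ratio_normal: "psi Pseq (Qseq cls) zeta \<in> ratio_normal_set (Qseq cls)"
  using occurs_ratio(2) by (simp add: ratio_normal_set_def block_count_psi)

lemma psi_not_normal: "psi Pseq (Qseq cls) zeta \<notin> normal_set (Qseq cls)"
proof
  assume "psi Pseq (Qseq cls) zeta \<in> normal_set (Qseq cls)"
  then have "(\<lambda>n. real (block_count (Qseq cls) [0] n (psi Pseq (Qseq cls) zeta)) / Qsum (Qseq cls) 1 n) \<longlonglongrightarrow> 1"
    by (simp add: normal_set_def)
  then have "(\<lambda>n. (\<Sum>j<n. of_bool (occurs [0] j)) / Qsum (Qseq cls) 1 n) \<longlonglongrightarrow> 1"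
    by (simp only: block_count_psi)
  from LIMSEQ_unique[OF zeros_vs_Qsum this] show False by simp
qed

section \<open>Uniform distribution mod 1\<close>

private lemma frac_in_class:
  assumes c: "copy_idx c = i" and t: "t \<in> Cls i j" and j: "j < i"
  defines "u \<equiv> frac ((\<Prod>k=1..start c + t. real (Qseq cls k)) * psi Pseq (Qseq cls) zeta)"
  shows "real j / real i \<le> u" and "u < real j / real i + 2 / (real i - 1)"
proof -
  have i: "i \<ge> 6" using copy_idx_ge_6[of c] c by simp
  have t': "t < length (Wblock i)" "Wblock i ! t = i" using t by (simp_all add: Cls_def)
  define q where "q = Qblock cls i ! t"
  have q: "q = (if j = 0 then i ^ 3 else i\<^sup>2 div j)" using Qblock_Cls[OF t] by (simp add: q_def)
  have q_pos: "q > 0" using Qblock_bounds(2)[OF i t'(1)] i by (simp add: q_def)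
  have "Qseq cls (Suc (start c + t)) = q" "Eseq (Suc (start c + t)) = i"
    using t' c by (simp_all add: Qseq_in_copy Eseq_in_copy q_def)
  then have u: "real i / real q \<le> u" "u < (real i + 1) / real q"
    using frac_cantor_bounds[OF basic_seq_Qseq expansion_hyps psi_sums, of "start c + t"]
    by (simp_all add: u_def)
  have lower: "j * q \<le> i * i"
    using q div_times_less_eq_dividend[of "i\<^sup>2" j] by (simp add: power2_eq_square mult.commute)
  have "real j * real q \<le> real i * real i"
    using of_nat_mono[OF lower, where 'a = real] by simp
  then have "real j / real i \<le> real i / real q"
    using i q_pos by (simp add: field_simps)
  then show "real j / real i \<le> u" using u(1) by simp
  have "(real i + 1) / real q \<le> real j / real i + 2 / (real i - 1)"
  proof (cases "j = 0")
    case True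
    \<comment> \<open>In the first class \<open>q = i^3\<close>, so the claim is
      \<open>(i+1) / i^3 \<le> 2 / (i-1)\<close>.\<close>
    have "(real i + 1) * (real i - 1) \<le> 2 * real i ^ 3"
    proof -
      have "(real i + 1) * (real i - 1) \<le> real i ^ 2" by (simp add: power2_eq_square algebra_simps)
      also have "\<dots> \<le> real i ^ 3" using i by (intro power_increasing) auto
      also have "\<dots> \<le> 2 * real i ^ 3" by simp
      finally show ?thesis .
    qed
    then show ?thesis using True q i by (simp add: field_simps)
  next
    case False
    \<comment> \<open>The floor loses less than 1, so \<open>q * j > i^2 - j\<close>; with
      \<open>j < i\<close> this gives \<open>q * j \<ge> i * (i - 1)\<close>.\<close>
    have "i * i < q * j + j"
      using q False dividend_less_div_times[of j "i\<^sup>2"] by (simp add: power2_eq_square algebra_simps)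
    then have "i * i \<le> q * j + i" using j by linarith
    then have "real (i * i) \<le> real (q * j + i)" by (rule of_nat_mono)
    then have qj: "real i * (real i - 1) \<le> real q * real j" by (simp add: algebra_simps)
    have "(real i + 1) / real q = (real i + 1) * real j / (real q * real j)"
      using False by simp
    also have "\<dots> \<le> (real i + 1) * real j / (real i * (real i - 1))"
      using qj i q_pos False by (intro divide_left_mono mult_pos_pos) auto
    \<comment> \<open>Uses \<open>(i+1) / (i-1) = 1 + 2 / (i-1)\<close>.\<close>
    also have "\<dots> = real j / real i + real j / real i * (2 / (real i - 1))"
      using i by (simp add: divide_simps) (simp add: algebra_simps)
    also have "\<dots> \<le> real j / real i + 1 * (2 / (real i - 1))"
      using j i by (intro add_left_mono mult_right_mono) auto
    finally show ?thesis by simp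
  qed
  then show "u < real j / real i + 2 / (real i - 1)" using u(2) by simp
qed

text \<open>A sandwich by whole classes: \<open>Cls i j\<close> has its fractional parts in
  \<open>[j/i, j/i + \<delta>)\<close>. The classes in \<open>inner\<close> map wholly into the
  target interval, and only those in \<open>outer\<close> can meet it. The three error terms are the
  share of digits below \<open>i\<close>, the width \<delta>, and the rounding in counting the
  integers \<open>j\<close>.\<close>

private lemma count_in_copy:
  fixes \<alpha> \<beta> :: real
  assumes ab: "0 \<le> \<alpha>" "\<alpha> < \<beta>" "\<beta> \<le> 1" and c: "copy_idx c = i"
  defines "u \<equiv> \<lambda>n. frac ((\<Prod>k=1..n. real (Qseq cls k)) * psi Pseq (Qseq cls) zeta)"
  shows "\<bar>(\<Sum>n\<in>copy c. of_bool (u n \<in> {\<alpha>..<\<beta>})) - (\<beta> - \<alpha>) * real (length (Wblock i))\<bar>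
           \<le> (real i / 2 ^ i + 2 / (real i - 1) + 1 / real i) * real (length (Wblock i))"
proof -
  have i: "i \<ge> 6" using copy_idx_ge_6[of c] c by simp
  define \<delta> where "\<delta> = 2 / (real i - 1)"
  have \<delta>: "\<delta> > 0" using i by (simp add: \<delta>_def)
  define L where "L = length (Wblock i)"
  define S where "S = {t. t < L \<and> u (start c + t) \<in> {\<alpha>..<\<beta>}}"
  define inner where "inner = {j. j < i \<and> \<alpha> * real i \<le> real j \<and> real j < (\<beta> - \<delta>) * real i}"
  define outer where "outer = {j. j < i \<and> (\<alpha> - \<delta>) * real i \<le> real j \<and> real j < \<beta> * real i}"
  have cls_u: "real j / real i \<le> u (start c + t)" "u (start c + t) < real j / real i + \<delta>"
    if "t \<in> Cls i j" "j < i" for t j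
    using frac_in_class[OF c that] by (simp_all add: u_def \<delta>_def)
  have "(\<Union>j\<in>inner. Cls i j) \<subseteq> S"
  proof
    fix t assume "t \<in> (\<Union>j\<in>inner. Cls i j)"
    then obtain j where j: "j \<in> inner" "t \<in> Cls i j" by blast
    then have "\<alpha> \<le> real j / real i" "real j / real i + \<delta> < \<beta>"
      using i by (auto simp: inner_def field_simps)
    moreover have "t < L" using j by (simp add: Cls_def L_def)
    ultimately show "t \<in> S" using cls_u[OF j(2)] j(1) by (simp add: S_def inner_def)
  qed
  then have "card (\<Union>j\<in>inner. Cls i j) \<le> card S"
    by (intro card_mono) (auto simp: S_def)
  then have lower: "real (card inner) * real (m i) \<le> real (card S)"
    using i by (subst (asm) card_UN_Cls) (auto simp: inner_def simp flip: of_nat_mult)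
  have "S \<subseteq> small i \<union> (\<Union>j\<in>outer. Cls i j)"
  proof
    fix t assume t: "t \<in> S"
    show "t \<in> small i \<union> (\<Union>j\<in>outer. Cls i j)"
    proof (cases "t \<in> small i")
      case False
      then obtain j where j: "j < i" "t \<in> Cls i j"
        using positions_Wblock[OF i] t by (auto simp: S_def L_def)
      then have "\<alpha> < real j / real i + \<delta>" "real j / real i < \<beta>"
        using cls_u[OF j(2,1)] t by (auto simp: S_def)
      then have "j \<in> outer" using i j(1) by (simp add: outer_def field_simps)
      then show ?thesis using j by blast
    qed simp
  qed
  then have "card S \<le> card (small i \<union> (\<Union>j\<in>outer. Cls i j))"
    by (intro card_mono) (auto simp: finite_small finite_Cls outer_def)
  also have "\<dots> \<le> card (small i) + card (\<Union>j\<in>outer. Cls i j)"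
    by (rule card_Un_le)
  also have "\<dots> = card (small i) + card outer * m i"
    using i by (subst card_UN_Cls) (auto simp: outer_def)
  finally have upper: "real (card S) \<le> real (card (small i)) + real (card outer) * real (m i)"
    by (simp flip: of_nat_mult of_nat_add)
  have "(\<beta> - \<delta>) * real i \<le> 1 * real i" using ab \<delta> by (intro mult_right_mono) auto
  then have "(\<beta> - \<delta>) * real i - \<alpha> * real i - 1 \<le> real (card inner)"
    unfolding inner_def using ab by (intro card_nat_ivl_lower) auto
  then have inner: "(\<beta> - \<alpha>) * real i - (\<delta> * real i + 1) \<le> real (card inner)"
    by (simp add: algebra_simps)
  have "real (card outer) \<le> \<beta> * real i - (\<alpha> - \<delta>) * real i + 1"
    unfolding outer_def using ab \<delta> by (intro card_nat_ivl_upper mult_right_mono) auto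
  then have outer: "real (card outer) \<le> (\<beta> - \<alpha>) * real i + (\<delta> * real i + 1)"
    by (simp add: algebra_simps)
  have "card (\<Union>j<i. Cls i j) + card (small i) = card {..<L}"
    unfolding L_def positions_Wblock[OF i] using finite_Cls finite_small
    by (subst card_Un_disjoint) (auto simp: small_def Cls_def)
  then have "i * m i + card (small i) = L" using i by (simp add: card_UN_Cls)
  then have L: "real L = real i * real (m i) + real (card (small i))"
    by (simp flip: of_nat_mult of_nat_add)
  have "((\<beta> - \<alpha>) * real i - (\<delta> * real i + 1)) * real (m i) \<le> real (card S)"
    using order_trans[OF mult_right_mono[OF inner] lower] by simp
  moreover have "real (card S) \<le> real (card (small i)) + ((\<beta> - \<alpha>) * real i + (\<delta> * real i + 1)) * real (m i)"
    using upper mult_right_mono[OF outer, of "real (m i)"] by simp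
  \<comment> \<open>\<open>L\<close> includes the positions in \<open>small i\<close>, so their
    share of the expected count is bounded as well.\<close>
  moreover have "0 \<le> (\<beta> - \<alpha>) * real (card (small i))" "(\<beta> - \<alpha>) * real (card (small i)) \<le> 1 * real (card (small i))"
    using ab mult_right_mono[of "\<beta> - \<alpha>" 1 "real (card (small i))"] by auto
  ultimately have "\<bar>real (card S) - (\<beta> - \<alpha>) * real L\<bar> \<le> real (card (small i)) + (\<delta> * real i + 1) * real (m i)"
    unfolding L by (simp add: algebra_simps abs_le_iff)
  also have "(\<delta> * real i + 1) * real (m i) = (\<delta> + 1 / real i) * (real i * real (m i))"
    using i by (simp add: field_simps)
  also have "\<dots> \<le> (\<delta> + 1 / real i) * real L"
    using \<delta> by (intro mult_left_mono) (auto simp: L)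
  also have "real (card (small i)) = real i / 2 ^ i * real L"
    using card_small[OF i] by (simp add: L_def)
  finally have "\<bar>real (card S) - (\<beta> - \<alpha>) * real L\<bar> \<le> (real i / 2 ^ i + \<delta> + 1 / real i) * real L"
    by (simp add: algebra_simps)
  moreover have "(\<Sum>n\<in>copy c. of_bool (u n \<in> {\<alpha>..<\<beta>})) = real (card S)"
    unfolding sum_copy c S_def L_def
    by (subst sum_of_bool_eq) (auto intro!: arg_cong[where f = card])
  ultimately show ?thesis by (simp only: L_def \<delta>_def)
qed

text \<open>With the constant weight 1, \<open>ratio_of_copy_sums\<close> turns the counts in single
  copies into the frequency among the first \<open>N\<close> terms; \<open>k = 0\<close> suffices,
  as \<open>|W_i| \<ge> 2^{i^3}\<close>.\<close>

lemma psi_distribution_normal: "psi Pseq (Qseq cls) zeta \<in> dist_normal_set (Qseq cls)"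
  unfolding dist_normal_set_def unif_dist_mod1_def mem_Collect_eq
proof (intro allI impI)
  fix \<alpha> \<beta> :: real assume ab: "0 \<le> \<alpha> \<and> \<alpha> < \<beta> \<and> \<beta> \<le> 1"
  define u where "u n = frac ((\<Prod>k=1..n. real (Qseq cls k)) * psi Pseq (Qseq cls) zeta)" for n
  let ?f = "\<lambda>n. of_bool (u n \<in> {\<alpha>..<\<beta>}) :: real" and ?g = "\<lambda>n. 1 :: real"
  have g: "sum ?g (copy b) = real (length (Wblock (copy_idx b)))" for b
    by (simp add: start_Suc)
  have near: "\<forall>\<^sub>F i in sequentially. \<forall>b. copy_idx b = i \<longrightarrow>
      \<bar>sum ?f (copy b) - (\<beta> - \<alpha>) * sum ?g (copy b)\<bar> \<le> \<eta> * sum ?g (copy b)" if \<eta>: "\<eta> > 0" for \<eta>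
  proof -
    have "(\<lambda>i. real i / 2 ^ i + 2 / (real i - 1) + 1 / real i) \<longlonglongrightarrow> 0" by real_asymp
    then have "\<forall>\<^sub>F i in sequentially. real i / 2 ^ i + 2 / (real i - 1) + 1 / real i < \<eta>"
      by (rule order_tendstoD) (use \<eta> in simp)
    then show ?thesis
    proof eventually_elim
      case (elim i)
      have le: "(real i / 2 ^ i + 2 / (real i - 1) + 1 / real i) * real (length (Wblock i))
          \<le> \<eta> * real (length (Wblock i))"
        using elim by (intro mult_right_mono) auto
      show ?case
        unfolding g u_def using order_trans[OF count_in_copy le] ab by blast
    qed
  qed
  have big: "\<forall>\<^sub>F i in sequentially. \<forall>b. copy_idx b = i \<longrightarrow> 2 ^ (i ^ 3) / 2 ^ (i * 0) \<le> sum ?g (copy b)"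
    using eventually_ge_at_top[of 6]
  proof eventually_elim
    case (elim i)
    have "1 * 2 ^ (i ^ 3) \<le> (real i)\<^sup>2 * 2 ^ (i ^ 3)"
      using elim by (intro mult_right_mono one_le_power) auto
    then show ?case unfolding g using elim by (simp add: length_Wblock)
  qed
  have "(\<lambda>N. sum ?f {..<N} / sum ?g {..<N}) \<longlonglongrightarrow> \<beta> - \<alpha>"
    by (rule ratio_of_copy_sums(2)[OF _ _ _ _ near big]) auto
  moreover have "sum ?f {..<N} = real (card {n. n < N \<and> u n \<in> {\<alpha>..<\<beta>}})" for N
    by (subst sum_of_bool_eq) (auto intro!: arg_cong[where f = card])
  ultimately show "(\<lambda>N. real (card {n. n < N \<and> frac ((\<Prod>j=1..n. real (Qseq cls j)) * psi Pseq (Qseq cls) zeta)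
      \<in> {\<alpha>..<\<beta>}}) / real N) \<longlonglongrightarrow> \<beta> - \<alpha>"
    by (simp add: u_def)
qed

end

theorem theorem3p11:
  fixes cls :: "nat \<Rightarrow> nat \<Rightarrow> nat"
  assumes "class_division cls"
  shows "basic_seq (Qseq cls) \<and> infinite_in_limit (Qseq cls) \<and> fully_divergent (Qseq cls) \<and>
         psi Pseq (Qseq cls) zeta
           \<in> (ratio_normal_set (Qseq cls) \<inter> dist_normal_set (Qseq cls)) - normal_set (Qseq cls)"
  using basic_seq_Qseq[OF assms] infinite_in_limit_Qseq[OF assms] fully_divergent_Qseq[OF assms]
    psi_ratio_normal[OF assms] psi_distribution_normal[OF assms] psi_not_normal[OF assms]
  by blast

end
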